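(* Let $0<\alpha\le 2$, let $\lambda=(\lambda_1,\lambda_2,\dots)\in \ell_1$ with $\lambda_1\ge\lambda_2\ge\dots\ge 0$, and let $\mu$ be the stable probability measure on $\ell_2$ with characteristic function $$\widehat{\mu}(y)=\exp\Big\{-\tfrac12\sum_{i=1}^\infty |y_i|^\alpha\lambda_i\Big\},\qquad y\in\ell_2 .$$ Let $\sigma_\alpha:[1,\infty)\to(0,\infty)$ be a differentiable decreasing function with $\sigma_\alpha(n)\le \lambda_n^{1/\alpha}$ for all $n=1,2,\dots$. With $\varphi,\Psi,H,K$ as defined in the context, let $\nu,\eta:\mathbb{R}_+\to\mathbb{N}$ be functions such that $\varepsilon\varphi(\nu(\varepsilon))\le 1$ for all $0<\varepsilon<\varphi(1)^{-1}$ and $\varepsilon\Psi(\eta(\varepsilon))\le 1$ for all $0<\varepsilon<\Psi(1)^{-1}$. Then for all $0<\varepsilon<(\max(\varphi(1),\Psi(1)))^{-1}$, $$\mu(D_\varepsilon)\le C(\alpha,\lambda_1)\exp\{-H(\nu(\varepsilon))-\log\varepsilon\},$$ $$\mu(S_\varepsilon)\le C(\alpha,\lambda_1)\exp\{-K(\eta(\varepsilon))-\log\varepsilon\},$$ and, if $\log\sigma_\alpha(x)$ is convex, then $$\mu(D_\varepsilon)\le C(\alpha,\lambda_1)\exp\{-H(\nu(\varepsilon))-\tfrac12\log\varepsilon\},$$ $$\mu(S_\varepsilon)\le C(\alpha,\lambda_1)\exp\{-K(\eta(\varepsilon))-\tfrac14\log(\varepsilon^2\eta(\varepsilon))\}.$$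 Here $C(\alpha,\lambda_1)$ denotes finite positive constants (possibly different in each inequality) depending only on $\alpha$ and $\lambda_1$.
   Context: $\ell_2$ is the real separable Hilbert space of square-summable sequences with scalar product $(x,y)=\sum_i x_iy_i$ and norm $\|x\|$; $\|x\|_\infty=\sup_i|x_i|$. The characteristic function of a probability measure $\mu$ on $\ell_2$ is $\widehat\mu(y)=\int e^{i(x,y)}\mu(dx)$. For $r>0$, $S_r=\{x\in\ell_2:\|x\|\le r\}$ and $D_r=\{x\in\ell_2:\|x\|_\infty\le r\}$. $\mathbb{N}$ is the set of positive integers. $p_\alpha$ is the density of the one-dimensional symmetric stable law with characteristic function $\exp\{-|t|^\alpha/2\}$; in particular $p_\alpha(0)=2^{1/\alpha}\Gamma(1/\alpha)/(\pi\alpha)$. Set $$C_0(\alpha)=\frac{2^{1/2+1/\alpha}\,\Gamma(1/\alpha)}{\sqrt{\pi}\,\alpha},\qquad \varphi(x)=\frac{2p_\alpha(0)}{\sigma_\alpha(x)},\qquad \Psi(x)=\frac{C_0(\alpha)}{\sigma_\alpha(x)\sqrt{x}},\qquad x\ge1,$$ $$H(y)=\int_1^y\frac{x\varphi'(x)}{\varphi(x)}\,dx,\qquad K(y)=\int_1^y\frac{x\Psi'(x)}{\Psi(x)}\,dx .$$ *)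

theory Defs
  imports "HOL-Probability.Probability"
begin

section \<open>The Hilbert space of square-summable real sequences\<close>

text \<open>
  Coordinates are indexed from 0: \<open>coord x i\<close> is the coordinate usually written \<open>x_{i+1}\<close>.
\<close>

typedef ell2 = "{x :: nat \<Rightarrow> real. summable (\<lambda>i. (x i)\<^sup>2)}"
  morphisms coord Abs_ell2
  by (rule exI[of _ "\<lambda>_. 0"]) simp

setup_lifting type_definition_ell2

lemma summable_mult_of_squares:
  fixes x y :: "nat \<Rightarrow> real"
  assumes "summable (\<lambda>i. (x i)\<^sup>2)" "summable (\<lambda>i. (y i)\<^sup>2)"
  shows "summable (\<lambda>i. x i * y i)"
proof (rule summable_comparison_test')
  show "summable (\<lambda>i. (x i)\<^sup>2 + (y i)\<^sup>2)"
    using assms by (rule summable_add)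
  show "norm (x i * y i) \<le> (x i)\<^sup>2 + (y i)\<^sup>2" for i
  proof -
    have "2 * (\<bar>x i\<bar> * \<bar>y i\<bar>) \<le> (x i)\<^sup>2 + (y i)\<^sup>2"
      using sum_squares_bound[of "\<bar>x i\<bar>" "\<bar>y i\<bar>"] by (simp add: mult.assoc)
    moreover have "0 \<le> \<bar>x i\<bar> * \<bar>y i\<bar>" by simp
    ultimately show ?thesis unfolding real_norm_def abs_mult by linarith
  qed
qed

lemma summable_square_add:
  fixes x y :: "nat \<Rightarrow> real"
  assumes "summable (\<lambda>i. (x i)\<^sup>2)" "summable (\<lambda>i. (y i)\<^sup>2)"
  shows "summable (\<lambda>i. (x i + y i)\<^sup>2)"
  unfolding power2_sum mult.assoc
  by (intro summable_add summable_mult assms summable_mult_of_squares)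

lemma summable_coord_square: "summable (\<lambda>i. (coord x i)\<^sup>2)"
  using coord[of x] by simp

lemma summable_coord_mult: "summable (\<lambda>i. coord x i * coord y i)"
  by (intro summable_mult_of_squares summable_coord_square)

instantiation ell2 :: real_vector
begin

lift_definition zero_ell2 :: ell2 is "\<lambda>_. 0" by simp

lift_definition plus_ell2 :: "ell2 \<Rightarrow> ell2 \<Rightarrow> ell2" is "\<lambda>x y i. x i + y i"
  by (rule summable_square_add)

lift_definition uminus_ell2 :: "ell2 \<Rightarrow> ell2" is "\<lambda>x i. - x i" by simp

lift_definition scaleR_ell2 :: "real \<Rightarrow> ell2 \<Rightarrow> ell2" is "\<lambda>r x i. r * x i"
  by (simp add: power_mult_distrib summable_mult)

definition minus_ell2 :: "ell2 \<Rightarrow> ell2 \<Rightarrow> ell2" where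
  "x - y = x + - (y :: ell2)"

instance
  by standard (unfold minus_ell2_def, (transfer, auto simp: algebra_simps)+)

end

instantiation ell2 :: real_inner
begin

definition inner_ell2 :: "ell2 \<Rightarrow> ell2 \<Rightarrow> real" where
  "inner x y = (\<Sum>i. coord x i * coord y i)"

definition norm_ell2 :: "ell2 \<Rightarrow> real" where
  "norm x = sqrt (inner x (x :: ell2))"

definition dist_ell2 :: "ell2 \<Rightarrow> ell2 \<Rightarrow> real" where
  "dist x y = norm (x - y :: ell2)"

definition sgn_ell2 :: "ell2 \<Rightarrow> ell2" where
  "sgn x = scaleR (inverse (norm x)) (x :: ell2)"

definition uniformity_ell2 :: "(ell2 \<times> ell2) filter" where
  "uniformity = (INF e\<in>{0 <..}. principal {(x, y :: ell2). dist x y < e})"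

definition open_ell2 :: "ell2 set \<Rightarrow> bool" where
  "open U = (\<forall>x\<in>U. eventually (\<lambda>(x', y). x' = x \<longrightarrow> y \<in> (U :: ell2 set)) uniformity)"

instance
proof
  fix x y z :: ell2 and r :: real
  show "inner x y = inner y x"
    by (simp add: inner_ell2_def mult.commute)
  show "inner (x + y) z = inner x z + inner y z"
    by (simp add: inner_ell2_def plus_ell2.rep_eq distrib_right
        suminf_add summable_coord_mult)
  show "inner (scaleR r x) y = r * inner x y"
    by (simp add: inner_ell2_def scaleR_ell2.rep_eq mult.assoc
        suminf_mult summable_coord_mult)
  show "0 \<le> inner x x"
    unfolding inner_ell2_def by (intro suminf_nonneg summable_coord_mult) simp
  have "inner x x = 0 \<longleftrightarrow> (\<forall>i. coord x i * coord x i = 0)"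
    unfolding inner_ell2_def
    by (intro suminf_eq_zero_iff summable_coord_mult) simp
  then show "inner x x = 0 \<longleftrightarrow> x = 0"
    by (simp add: coord_inject[symmetric] zero_ell2.rep_eq fun_eq_iff)
qed (rule dist_ell2_def sgn_ell2_def uniformity_ell2_def open_ell2_def norm_ell2_def)+

end

definition sup_norm :: "ell2 \<Rightarrow> real" where
  "sup_norm x = (SUP i. \<bar>coord x i\<bar>)"

definition S_ball :: "real \<Rightarrow> ell2 set" where
  "S_ball r = {x. norm x \<le> r}"

definition D_ball :: "real \<Rightarrow> ell2 set" where
  "D_ball r = {x. sup_norm x \<le> r}"

definition char_fun :: "ell2 measure \<Rightarrow> ell2 \<Rightarrow> complex" where
  "char_fun M y = (CLINT x|M. iexp (inner x y))"

section \<open>Symmetric stable laws on the line\<close>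

text \<open>
  A Lebesgue density is unique only up to null sets; continuity selects the version whose
  value at 0 is meaningful.
\<close>

definition is_stable_density :: "real \<Rightarrow> (real \<Rightarrow> real) \<Rightarrow> bool" where
  "is_stable_density \<alpha> p \<longleftrightarrow>
     continuous_on UNIV p \<and> (\<forall>x. 0 \<le> p x) \<and>
     real_distribution (density lborel (\<lambda>x. ennreal (p x))) \<and>
     (\<forall>t. char (density lborel (\<lambda>x. ennreal (p x))) t
            = complex_of_real (exp (- (\<bar>t\<bar> powr \<alpha>) / 2)))"

definition stable_density :: "real \<Rightarrow> real \<Rightarrow> real" where
  "stable_density \<alpha> = (THE p. is_stable_density \<alpha> p)"

definition C0 :: "real \<Rightarrow> real" where
  "C0 \<alpha> = 2 powr (1 / 2 + 1 / \<alpha>) * Gamma (1 / \<alpha>) / (sqrt pi * \<alpha>)"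

definition phi :: "real \<Rightarrow> (real \<Rightarrow> real) \<Rightarrow> real \<Rightarrow> real" where
  "phi \<alpha> \<sigma> x = 2 * stable_density \<alpha> 0 / \<sigma> x"

definition Psi :: "real \<Rightarrow> (real \<Rightarrow> real) \<Rightarrow> real \<Rightarrow> real" where
  "Psi \<alpha> \<sigma> x = C0 \<alpha> / (\<sigma> x * sqrt x)"

text \<open>
  The functions involved live on \<open>[1, \<infinity>)\<close>, so the derivative is taken within that interval
  (one-sided at 1).
\<close>

definition log_slope_integral :: "(real \<Rightarrow> real) \<Rightarrow> real \<Rightarrow> real" where
  "log_slope_integral f y =
     integral {1..y} (\<lambda>x. x * vector_derivative f (at x within {1..}) / f x)"

definition H :: "real \<Rightarrow> (real \<Rightarrow> real) \<Rightarrow> real \<Rightarrow> real" where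
  "H \<alpha> \<sigma> = log_slope_integral (phi \<alpha> \<sigma>)"

definition K :: "real \<Rightarrow> (real \<Rightarrow> real) \<Rightarrow> real \<Rightarrow> real" where
  "K \<alpha> \<sigma> = log_slope_integral (Psi \<alpha> \<sigma>)"

end

theory Submission
  imports Defs "HOL-Real_Asymp.Real_Asymp"
begin

text \<open>
  The first \<open>n\<close> coordinates of a point drawn from the stable measure have the characteristic function
  \<open>\<Prod>i<n. exp (- \<bar>t\<^sub>i\<bar>\<^sup>\<alpha> \<lambda>\<^sub>i / 2)\<close>. It is integrable, so their joint density is at most the integral
  of its modulus divided by \<open>(2 \<pi>)\<^sup>n\<close>, which is the product of \<open>p\<^sub>\<alpha>(0) / \<lambda>\<^sub>i\<^sup>1\<^sup>/\<^sup>\<alpha>\<close>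
  (\<open>joint_density_bound\<close>). A ball of radius \<open>\<epsilon>\<close> lies in the cylinder over the cube of side \<open>2 \<epsilon>\<close>,
  respectively over the Euclidean ball of radius \<open>\<epsilon>\<close>, in dimension \<open>n\<close>; multiplying the density bound by
  the volume and replacing \<open>\<lambda>\<^sub>i\<^sup>1\<^sup>/\<^sup>\<alpha>\<close> by the smaller \<open>\<sigma>(i)\<close> gives, for every \<open>n\<close>,
  a bound on the measure of the ball (\<open>measure_D_ball_le\<close>, \<open>measure_S_ball_le\<close>).

  For the cube the bound is \<open>\<Prod>i\<le>n. \<epsilon> \<phi>(i)\<close>. Its logarithm is \<open>n ln \<epsilon> + \<Sum>i\<le>n. ln \<phi>(i)\<close>, and the sum
  exceeds the integral of \<open>ln \<phi>\<close> over \<open>[1, n]\<close> by at most \<open>ln \<phi>(n)\<close>, as \<open>ln \<phi>\<close> increases; if it is also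
  concave, the trapezoidal rule improves the error to \<open>(ln \<phi>(1) + ln \<phi>(n)) / 2\<close>. Integration by parts
  turns the integral into \<open>n ln \<phi>(n) - ln \<phi>(1) - H(n)\<close>. At \<open>n = \<nu>(\<epsilon>)\<close> the condition \<open>\<epsilon> \<phi>(n) \<le> 1\<close>
  makes \<open>n ln (\<epsilon> \<phi>(n))\<close> nonpositive and bounds the error term by \<open>- ln \<epsilon>\<close> or half of it, and
  \<open>1 / \<phi>(1)\<close> is at most a multiple of \<open>\<lambda>\<^sub>1\<^sup>1\<^sup>/\<^sup>\<alpha>\<close>.

  For the Euclidean ball the function \<open>\<Psi>\<close> may fail to be monotone, so only the sum of \<open>- ln \<sigma>(i)\<close> is compared
  with an integral. The factor \<open>1 / \<surd>x\<close> in \<open>\<Psi>\<close> comes from the volume of the unit ball: a Stirling-type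
  lower bound for \<open>\<Gamma>(n/2 + 1)\<close> shows that \<open>ln\<close> of this volume is, up to an additive constant, at most
  \<open>n/2 ln (2 \<pi>)\<close> minus half the integral of \<open>ln\<close> over \<open>[1, n]\<close> minus \<open>1/2 ln n\<close>. The last term completes
  \<open>- ln \<sigma>(n)\<close> to \<open>ln \<Psi>(n)\<close>, which gives the first estimate; in the convex case only half of it is needed
  for that, and the other half is the gain of \<open>1/4 ln \<eta>(\<epsilon>)\<close>.

  That the value at 0 of the stable density is the explicit constant in \<open>C\<^sub>0(\<alpha>)\<close> is \<open>stable_density_0\<close>:
  the first coordinate of the stable measure, rescaled, has the required characteristic function, and
  Levy's inversion formula provides its continuous density.
\<close>

section \<open>Bounding the density of a random vector by its characteristic function\<close>

text \<open>
  The Gaussian is its own Fourier transform. Writing the narrow Gaussian with variance \<open>1 / T\<^sup>2\<close> as an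
  expectation over a standard normal variable reduces the smoothing argument below to Fubini for
  bounded functions on probability spaces.
\<close>

lemma normal_density_eq_char:
  assumes "0 < T"
  shows "complex_of_real (normal_density 0 (1 / T) u)
    = (T / sqrt (2 * pi)) * (CLINT s|std_normal_distribution. iexp (T * u * s))"
proof -
  have "normal_density 0 (1 / T) u = T / sqrt (2 * pi) * exp (- (T * u)\<^sup>2 / 2)"
    using assms by (simp add: normal_density_def real_sqrt_divide power_mult_distrib power_divide)
  moreover have "(CLINT s|std_normal_distribution. iexp (T * u * s))
      = complex_of_real (exp (- (T * u)\<^sup>2 / 2))"
    using fun_cong[OF char_std_normal_distribution, of "T * u"] by (simp add: char_def)
  ultimately show ?thesis by simp
qed

text \<open>
  After convolution with a Gaussian, the law of a random vector has a density, whose value at \<open>a\<close> is the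
  left-hand side. Fubini expresses it as the inverse Fourier integral of the characteristic function,
  damped by a Gaussian factor; estimating that integrand by its modulus gives a bound in which
  neither \<open>a\<close> nor \<open>T\<close> occurs.
\<close>

lemma smoothed_density_bound:
  fixes X :: "'i \<Rightarrow> 'a \<Rightarrow> real" and f :: "'i \<Rightarrow> real \<Rightarrow> real"
  assumes "prob_space M" and I: "finite I"
    and X[measurable]: "\<And>i. i \<in> I \<Longrightarrow> X i \<in> borel_measurable M"
    and char: "\<And>t. (CLINT x|M. iexp (\<Sum>i\<in>I. t i * X i x)) = (\<Prod>i\<in>I. complex_of_real (f i (t i)))"
    and f: "\<And>i. i \<in> I \<Longrightarrow> integrable lborel (f i)"
    and f0: "\<And>i t. i \<in> I \<Longrightarrow> 0 \<le> f i t" and f1: "\<And>i t. i \<in> I \<Longrightarrow> f i t \<le> 1"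
    and T: "0 < T"
  shows "(\<integral>x. (\<Prod>i\<in>I. normal_density 0 (1 / T) (X i x - a i)) \<partial>M)
    \<le> (\<Prod>i\<in>I. (\<integral>t. f i t \<partial>lborel) / (2 * pi))"
proof -
  let ?N = std_normal_distribution
  let ?P = "Pi\<^sub>M I (\<lambda>_. ?N)"
  interpret M: prob_space M by fact
  interpret N: real_distribution ?N by (rule real_dist_normal_dist)
  interpret P: product_prob_space "\<lambda>_. ?N" I by unfold_locales
  interpret P: finite_product_prob_space "\<lambda>_. ?N" I by unfold_locales (rule I)
  interpret MP: pair_prob_space M ?P by unfold_locales
  define g where "g x t = (\<Prod>i\<in>I. iexp (T * (X i x - a i) * t i))" for x and t :: "'i \<Rightarrow> real"
  define h where "h i s = iexp (- (T * a i * s)) * complex_of_real (f i (T * s))" for i s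
  have fm[measurable]: "f i \<in> borel_measurable borel" if "i \<in> I" for i
    using borel_measurable_integrable[OF f[OF that]] by simp
  have g1: "cmod (g x t) = 1" for x t
    by (simp add: g_def prod_norm[symmetric])
  have gm: "case_prod g \<in> borel_measurable (M \<Otimes>\<^sub>M ?P)"
    unfolding g_def by measurable
  have "complex_of_real (\<Prod>i\<in>I. normal_density 0 (1 / T) (X i x - a i))
      = (T / sqrt (2 * pi)) ^ card I * (CLINT t|?P. g x t)" for x
  proof -
    have "(CLINT t|?P. g x t) = (\<Prod>i\<in>I. CLINT s|?N. iexp (T * (X i x - a i) * s))"
      unfolding g_def using I
      by (intro P.product_integral_prod N.integrable_const_bound[where B=1]) auto
    then show ?thesis
      by (simp only: of_real_prod of_real_power normal_density_eq_char[OF T] prod.distrib prod_constant)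
  qed
  then have "complex_of_real (\<integral>x. (\<Prod>i\<in>I. normal_density 0 (1 / T) (X i x - a i)) \<partial>M)
      = (T / sqrt (2 * pi)) ^ card I * (CLINT x|M. CLINT t|?P. g x t)"
    by (simp flip: integral_complex_of_real)
  also have "(CLINT x|M. CLINT t|?P. g x t) = (CLINT t|?P. CLINT x|M. g x t)"
    by (intro MP.Fubini_integral[symmetric] MP.integrable_const_bound[where B=1] gm)
      (auto simp: g1 split_beta)
  also have "\<dots> = (CLINT t|?P. \<Prod>i\<in>I. h i (t i))"
  proof (intro Bochner_Integration.integral_cong refl)
    fix t
    have "g x t = (\<Prod>i\<in>I. iexp (- (T * a i * t i))) * iexp (\<Sum>i\<in>I. (T * t i) * X i x)" for x
      by (simp add: g_def exp_sum I sum_distrib_left prod.distrib[symmetric] exp_add[symmetric])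
        (simp add: algebra_simps)
    then have "(CLINT x|M. g x t)
        = (\<Prod>i\<in>I. iexp (- (T * a i * t i))) * (CLINT x|M. iexp (\<Sum>i\<in>I. (T * t i) * X i x))"
      by simp
    also have "\<dots> = (\<Prod>i\<in>I. h i (t i))"
      by (subst char) (simp add: h_def prod.distrib)
    finally show "(CLINT x|M. g x t) = (\<Prod>i\<in>I. h i (t i))" .
  qed
  also have "\<dots> = (\<Prod>i\<in>I. CLINT s|?N. h i s)"
    using I f0 f1
    by (intro P.product_integral_prod N.integrable_const_bound[where B=1])
      (auto simp: h_def norm_mult)
  finally have eq: "complex_of_real (\<integral>x. (\<Prod>i\<in>I. normal_density 0 (1 / T) (X i x - a i)) \<partial>M)
      = (T / sqrt (2 * pi)) ^ card I * (\<Prod>i\<in>I. CLINT s|?N. h i s)" .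
  have "(\<integral>x. (\<Prod>i\<in>I. normal_density 0 (1 / T) (X i x - a i)) \<partial>M)
      \<le> cmod (complex_of_real (\<integral>x. (\<Prod>i\<in>I. normal_density 0 (1 / T) (X i x - a i)) \<partial>M))"
    by simp
  also have "\<dots> = cmod ((T / sqrt (2 * pi)) ^ card I * (\<Prod>i\<in>I. CLINT s|?N. h i s))"
    by (simp only: eq)
  also have "\<dots> = (T / sqrt (2 * pi)) ^ card I * (\<Prod>i\<in>I. cmod (CLINT s|?N. h i s))"
    using T by (simp add: norm_mult norm_power norm_divide prod_norm)
  also have "\<dots> \<le> (T / sqrt (2 * pi)) ^ card I
      * (\<Prod>i\<in>I. (\<integral>t. f i t \<partial>lborel) / (T * sqrt (2 * pi)))"
  proof (intro mult_left_mono prod_mono conjI norm_ge_zero)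
    fix i assume i: "i \<in> I"
    have int: "integrable lborel (\<lambda>s. f i (T * s))"
      using lborel_integrable_real_affine[OF f[OF i], of T 0] T by simp
    have le: "std_normal_density s * f i (T * s) \<le> 1 / sqrt (2 * pi) * f i (T * s)" for s
      using f0[OF i] by (intro mult_right_mono) (auto simp: std_normal_density_def intro!: divide_right_mono)
    have "cmod (CLINT s|?N. h i s) \<le> (LINT s|?N. cmod (h i s))"
      by (rule integral_norm_bound)
    also have "\<dots> = (LINT s|?N. f i (T * s))"
      using f0[OF i] by (simp add: h_def norm_mult)
    also have "\<dots> = (LINT s|lborel. std_normal_density s * f i (T * s))"
      using i by (subst integral_density) auto
    also have "\<dots> \<le> (LINT s|lborel. 1 / sqrt (2 * pi) * f i (T * s))"
    proof (rule integral_mono_AE)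
      show "integrable lborel (\<lambda>s. 1 / sqrt (2 * pi) * f i (T * s))"
        using int by simp
      then show "integrable lborel (\<lambda>s. std_normal_density s * f i (T * s))"
        by (rule Bochner_Integration.integrable_bound) (use i le f0[OF i] in auto)
    qed (use le in auto)
    also have "\<dots> = (\<integral>t. f i t \<partial>lborel) / (T * sqrt (2 * pi))"
      using T lborel_integral_real_affine[of T "f i" 0] by (simp add: field_simps)
    finally show "cmod (CLINT s|?N. h i s) \<le> (\<integral>t. f i t \<partial>lborel) / (T * sqrt (2 * pi))" .
  qed (use T in auto)
  also have "\<dots> = (\<Prod>i\<in>I. T / sqrt (2 * pi) * ((\<integral>t. f i t \<partial>lborel) / (T * sqrt (2 * pi))))"
    by (simp only: prod.distrib prod_constant)
  also have "\<dots> = (\<Prod>i\<in>I. (\<integral>t. f i t \<partial>lborel) / (2 * pi))"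
    using T by (intro prod.cong) auto
  finally show ?thesis .
qed

lemma normal_density_window:
  assumes "0 < T"
  shows "(\<integral>\<^sup>+s. indicator {- \<delta>..\<delta>} (u - s) * ennreal (normal_density 0 (1 / T) (u - s)) \<partial>lborel)
    = emeasure std_normal_distribution {- (T * \<delta>)..T * \<delta>}"
proof -
  have "(\<integral>\<^sup>+s. indicator {- \<delta>..\<delta>} (u - s) * ennreal (normal_density 0 (1 / T) (u - s)) \<partial>lborel)
     = ennreal (1 / T) * (\<integral>\<^sup>+v. indicator {- \<delta>..\<delta>} (v / T)
          * ennreal (normal_density 0 (1 / T) (v / T)) \<partial>lborel)"
    using assms by (subst nn_integral_real_affine[of _ "- 1 / T" u]) auto
  also have "\<dots> = (\<integral>\<^sup>+v. ennreal (1 / T) * (indicator {- \<delta>..\<delta>} (v / T)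
          * ennreal (normal_density 0 (1 / T) (v / T))) \<partial>lborel)"
    by (intro nn_integral_cmult[symmetric]) simp
  also have "\<dots> = (\<integral>\<^sup>+v. ennreal (std_normal_density v) * indicator {- (T * \<delta>)..T * \<delta>} v \<partial>lborel)"
  proof (rule nn_integral_cong)
    fix v :: real
    have "1 / T * normal_density 0 (1 / T) (v / T) = std_normal_density v"
      using assms by (simp add: normal_density_def real_sqrt_divide power_divide)
    then have "ennreal (1 / T) * ennreal (normal_density 0 (1 / T) (v / T)) = std_normal_density v"
      using assms by (simp flip: ennreal_mult'')
    moreover have "indicator {- \<delta>..\<delta>} (v / T) = (indicator {- (T * \<delta>)..T * \<delta>} v :: ennreal)"
      using assms by (auto simp: indicator_def field_simps)
    ultimately show "ennreal (1 / T) * (indicator {- \<delta>..\<delta>} (v / T)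
        * ennreal (normal_density 0 (1 / T) (v / T)))
      = ennreal (std_normal_density v) * indicator {- (T * \<delta>)..T * \<delta>} v"
      by (metis mult.commute mult.left_commute)
  qed
  also have "\<dots> = emeasure std_normal_distribution {- (T * \<delta>)..T * \<delta>}"
    by (simp add: emeasure_density)
  finally show ?thesis .
qed

text \<open>
  Integrate the bound on the smoothed density over \<open>B\<close> and let \<open>T\<close> tend to infinity: as \<open>B\<close> contains the
  cube of half-width \<open>\<delta>\<close> around each point of \<open>A\<close>, the smoothing keeps in \<open>B\<close> all but a vanishing part of
  the mass that sat in \<open>A\<close>. The margin \<open>\<delta>\<close> avoids any regularity assumption on the boundary of \<open>A\<close>.
\<close>

lemma joint_density_bound:
  fixes X :: "'i \<Rightarrow> 'a \<Rightarrow> real" and f :: "'i \<Rightarrow> real \<Rightarrow> real"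
  assumes "prob_space M" and I: "finite I"
    and X[measurable]: "\<And>i. i \<in> I \<Longrightarrow> X i \<in> borel_measurable M"
    and char: "\<And>t. (CLINT x|M. iexp (\<Sum>i\<in>I. t i * X i x)) = (\<Prod>i\<in>I. complex_of_real (f i (t i)))"
    and f: "\<And>i. i \<in> I \<Longrightarrow> integrable lborel (f i)"
    and f0: "\<And>i t. i \<in> I \<Longrightarrow> 0 \<le> f i t" and f1: "\<And>i t. i \<in> I \<Longrightarrow> f i t \<le> 1"
    and A[measurable]: "A \<in> sets (Pi\<^sub>M I (\<lambda>_. lborel))"
    and B[measurable]: "B \<in> sets (Pi\<^sub>M I (\<lambda>_. lborel))"
    and \<delta>: "0 < \<delta>"
    and AB: "\<And>x y. x \<in> A \<Longrightarrow> y \<in> space (Pi\<^sub>M I (\<lambda>_. lborel)) \<Longrightarrow>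
      (\<And>i. i \<in> I \<Longrightarrow> \<bar>x i - y i\<bar> \<le> \<delta>) \<Longrightarrow> y \<in> B"
  shows "emeasure M {x \<in> space M. (\<lambda>i\<in>I. X i x) \<in> A}
    \<le> ennreal (\<Prod>i\<in>I. (\<integral>t. f i t \<partial>lborel) / (2 * pi)) * emeasure (Pi\<^sub>M I (\<lambda>_. lborel)) B"
    (is "emeasure M ?E \<le> ennreal ?c * emeasure ?L B")
proof -
  let ?N = std_normal_distribution
  interpret M: prob_space M by fact
  interpret N: real_distribution ?N by (rule real_dist_normal_dist)
  interpret L: product_sigma_finite "\<lambda>_::'i. lborel :: real measure" by unfold_locales
  interpret L: finite_product_sigma_finite "\<lambda>_::'i. lborel :: real measure" I
    by unfold_locales (rule I)
  interpret MP: pair_sigma_finite M ?L by unfold_locales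
  have XI[measurable]: "(\<lambda>x. \<lambda>i\<in>I. X i x) \<in> measurable M ?L"
    by (rule measurable_restrict) simp
  have E[measurable]: "?E \<in> sets M" by measurable
  \<comment> \<open>The factor on the left is the mass that a Gaussian of width \<open>1 / T\<close> puts on a cube of half-width \<open>\<delta>\<close>.\<close>
  have bound: "ennreal (measure ?N {- (T * \<delta>)..T * \<delta>} ^ card I * measure M ?E)
      \<le> ennreal ?c * emeasure ?L B" if T: "0 < T" for T
  proof -
    define G where "G x a = (\<Prod>i\<in>I. ennreal (normal_density 0 (1 / T) (X i x - a i)))" for x a
    have Gm[measurable]: "case_prod G \<in> borel_measurable (M \<Otimes>\<^sub>M ?L)"
      unfolding G_def by measurable
    have "ennreal (measure ?N {- (T * \<delta>)..T * \<delta>} ^ card I * measure M ?E)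
        = (\<integral>\<^sup>+x. emeasure ?N {- (T * \<delta>)..T * \<delta>} ^ card I * indicator ?E x \<partial>M)"
      by (simp add: nn_integral_cmult_indicator ennreal_mult ennreal_power
          N.emeasure_eq_measure M.emeasure_eq_measure)
    also have "\<dots> \<le> (\<integral>\<^sup>+x. \<integral>\<^sup>+a. G x a * indicator B a \<partial>?L \<partial>M)"
    proof (rule nn_integral_mono)
      fix x assume x: "x \<in> space M"
      show "emeasure ?N {- (T * \<delta>)..T * \<delta>} ^ card I * indicator ?E x
          \<le> (\<integral>\<^sup>+a. G x a * indicator B a \<partial>?L)"
      proof (cases "x \<in> ?E")
        case True
        have "emeasure ?N {- (T * \<delta>)..T * \<delta>} ^ card I
            = (\<Prod>i\<in>I. \<integral>\<^sup>+s. indicator {- \<delta>..\<delta>} (X i x - s)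
                * ennreal (normal_density 0 (1 / T) (X i x - s)) \<partial>lborel)"
          by (simp add: normal_density_window[OF T])
        also have "\<dots> = (\<integral>\<^sup>+a. (\<Prod>i\<in>I. indicator {- \<delta>..\<delta>} (X i x - a i)
                * ennreal (normal_density 0 (1 / T) (X i x - a i))) \<partial>?L)"
          using I by (subst L.product_nn_integral_prod) auto
        also have "\<dots> \<le> (\<integral>\<^sup>+a. G x a * indicator B a \<partial>?L)"
        proof (rule nn_integral_mono)
          fix a assume a: "a \<in> space ?L"
          show "(\<Prod>i\<in>I. indicator {- \<delta>..\<delta>} (X i x - a i)
                * ennreal (normal_density 0 (1 / T) (X i x - a i))) \<le> G x a * indicator B a"
          proof (cases "\<forall>i\<in>I. X i x - a i \<in> {- \<delta>..\<delta>}")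
            case True
            then have "a \<in> B"
              using \<open>x \<in> ?E\<close> by (intro AB[of "\<lambda>i\<in>I. X i x", OF _ a]) (auto simp: abs_le_iff)
            with True show ?thesis by (simp add: G_def)
          next
            case False
            then obtain i where "i \<in> I" "X i x - a i \<notin> {- \<delta>..\<delta>}" by auto
            then have "(\<Prod>i\<in>I. indicator {- \<delta>..\<delta>} (X i x - a i)
                * ennreal (normal_density 0 (1 / T) (X i x - a i))) = 0"
              by (intro prod_zero[OF I] bexI[of _ i]) auto
            then show ?thesis by (simp only: zero_le)
          qed
        qed
        finally show ?thesis using True by simp
      qed simp
    qed
    also have "\<dots> = (\<integral>\<^sup>+a. \<integral>\<^sup>+x. G x a * indicator B a \<partial>M \<partial>?L)"
      by (intro MP.Fubini'[symmetric]) measurable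
    also have "\<dots> \<le> (\<integral>\<^sup>+a. ennreal ?c * indicator B a \<partial>?L)"
    proof (rule nn_integral_mono)
      fix a assume a: "a \<in> space ?L"
      have "(\<integral>\<^sup>+x. G x a \<partial>M)
          = ennreal (\<integral>x. (\<Prod>i\<in>I. normal_density 0 (1 / T) (X i x - a i)) \<partial>M)"
      proof -
        have "(\<integral>\<^sup>+x. G x a \<partial>M)
            = (\<integral>\<^sup>+x. ennreal (\<Prod>i\<in>I. normal_density 0 (1 / T) (X i x - a i)) \<partial>M)"
          by (simp add: G_def prod_ennreal)
        also have "\<dots> = ennreal (\<integral>x. (\<Prod>i\<in>I. normal_density 0 (1 / T) (X i x - a i)) \<partial>M)"
        proof (rule nn_integral_eq_integral)
          have "normal_density 0 (1 / T) u \<le> 1 / sqrt (2 * pi * (1 / T)\<^sup>2)" for u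
            unfolding normal_density_def by (intro mult_left_le) auto
          then have "(\<Prod>i\<in>I. normal_density 0 (1 / T) (X i x - a i))
              \<le> (\<Prod>i\<in>I. 1 / sqrt (2 * pi * (1 / T)\<^sup>2))" for x
            by (intro prod_mono) auto
          then show "integrable M (\<lambda>x. \<Prod>i\<in>I. normal_density 0 (1 / T) (X i x - a i))"
            by (intro M.integrable_const_bound[where B="(1 / sqrt (2 * pi * (1 / T)\<^sup>2)) ^ card I"])
              (auto simp: abs_prod)
        qed (simp add: prod_nonneg)
        finally show ?thesis .
      qed
      also have "\<dots> \<le> ennreal ?c"
        by (intro ennreal_leI smoothed_density_bound assms T) 
      finally have "(\<integral>\<^sup>+x. G x a \<partial>M) \<le> ennreal ?c" .
      then show "(\<integral>\<^sup>+x. G x a * indicator B a \<partial>M) \<le> ennreal ?c * indicator B a"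
        by (cases "a \<in> B") auto
    qed
    also have "\<dots> = ennreal ?c * emeasure ?L B"
      by (simp add: nn_integral_cmult_indicator)
    finally show ?thesis .
  qed
  have "(\<lambda>k. measure ?N {- (real k * \<delta>)..real k * \<delta>}) \<longlonglongrightarrow> measure ?N (\<Union>k. {- (real k * \<delta>)..real k * \<delta>})"
    using \<delta> by (intro N.finite_Lim_measure_incseq)
      (auto simp: incseq_def intro: order_trans[OF _ mult_right_mono] mult_right_mono)
  also have "(\<Union>k. {- (real k * \<delta>)..real k * \<delta>}) = UNIV"
  proof (intro set_eqI iffI UNIV_I)
    fix x :: real
    obtain k :: nat where "\<bar>x\<bar> / \<delta> \<le> real k" using real_arch_simple by blast
    then show "x \<in> (\<Union>k. {- (real k * \<delta>)..real k * \<delta>})"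
      using \<delta> by (intro UN_I[of k]) (auto simp: field_simps abs_le_iff)
  qed
  also have "measure ?N UNIV = 1"
    using N.prob_space by simp
  finally have "(\<lambda>k. measure ?N {- (real k * \<delta>)..real k * \<delta>} ^ card I * measure M ?E)
      \<longlonglongrightarrow> 1 ^ card I * measure M ?E"
    by (intro tendsto_intros)
  then have "(\<lambda>k. ennreal (measure ?N {- (real k * \<delta>)..real k * \<delta>} ^ card I * measure M ?E))
      \<longlonglongrightarrow> ennreal (1 ^ card I * measure M ?E)"
    by (rule tendsto_ennrealI)
  then have "ennreal (1 ^ card I * measure M ?E) \<le> ennreal ?c * emeasure ?L B"
    by (rule LIMSEQ_le_const2) (use bound in \<open>auto intro!: exI[of _ 1]\<close>)
  then show ?thesis by (simp add: M.emeasure_eq_measure)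
qed

section \<open>Continuous densities from integrable characteristic functions\<close>

text \<open>
  The inverse Fourier transform of a characteristic function \<open>h\<close> that is real, hence even: the sine part
  of \<open>exp (- \<i> t x)\<close> integrates to zero and is left out.
\<close>

definition inverse_transform :: "(real \<Rightarrow> real) \<Rightarrow> real \<Rightarrow> real" where
  "inverse_transform h x = (\<integral>t. h t * cos (t * x) \<partial>lborel) / (2 * pi)"

lemma continuous_on_inverse_transform:
  assumes h: "integrable lborel h"
  shows "continuous_on UNIV (inverse_transform h)"
proof (rule continuous_at_imp_continuous_on, rule ballI)
  fix x :: real
  have hm[measurable]: "h \<in> borel_measurable borel"
    using borel_measurable_integrable[OF h] by simp
  show "isCont (inverse_transform h) x"
    unfolding continuous_at_sequentially
  proof safe
    fix u :: "nat \<Rightarrow> real" assume u: "u \<longlonglongrightarrow> x"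
    have "(\<lambda>n. \<integral>t. h t * cos (t * u n) \<partial>lborel) \<longlonglongrightarrow> (\<integral>t. h t * cos (t * x) \<partial>lborel)"
      by (rule integral_dominated_convergence[where w="\<lambda>t. \<bar>h t\<bar>"])
        (use h u in \<open>auto intro!: tendsto_intros AE_I2 mult_left_le simp: abs_mult\<close>)
    then show "(inverse_transform h \<circ> u) \<longlonglongrightarrow> inverse_transform h x"
      unfolding inverse_transform_def comp_def by (intro tendsto_intros) auto
  qed
qed

lemma abs_inverse_transform_le:
  assumes h: "integrable lborel h"
  shows "\<bar>inverse_transform h x\<bar> \<le> (\<integral>t. \<bar>h t\<bar> \<partial>lborel) / (2 * pi)"
proof -
  have hm[measurable]: "h \<in> borel_measurable borel"
    using borel_measurable_integrable[OF h] by simp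
  have hcos: "integrable lborel (\<lambda>t. h t * cos (t * x))"
    by (rule Bochner_Integration.integrable_bound[OF h]) (auto simp: abs_mult intro!: mult_left_le AE_I2)
  have "\<bar>\<integral>t. h t * cos (t * x) \<partial>lborel\<bar> \<le> (\<integral>t. \<bar>h t * cos (t * x)\<bar> \<partial>lborel)"
    by (rule integral_abs_bound)
  also have "\<dots> \<le> (\<integral>t. \<bar>h t\<bar> \<partial>lborel)"
    by (intro integral_mono integrable_abs h hcos) (auto simp: abs_mult intro!: mult_left_le)
  finally show ?thesis
    unfolding inverse_transform_def by (simp add: divide_right_mono)
qed

text \<open>
  In Levy's inversion formula the kernel is bounded by \<open>b - a\<close>, so for integrable \<open>h\<close> the principal value
  is an ordinary integral. The real part of the kernel is the integral of \<open>cos (t x)\<close> over \<open>[a, b]\<close>, and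
  Fubini moves that integral outside.
\<close>

lemma measure_Ioc_eq_integral_inverse_transform:
  fixes h :: "real \<Rightarrow> real"
  assumes "real_distribution M" and char: "\<And>t. char M t = complex_of_real (h t)"
    and h: "integrable lborel h"
    and ab: "a \<le> b" and atoms: "measure M {a} = 0" "measure M {b} = 0"
  shows "measure M {a<..b} = integral {a..b} (inverse_transform h)"
proof -
  interpret M: real_distribution M by fact
  have hm[measurable]: "h \<in> borel_measurable borel"
    using borel_measurable_integrable[OF h] by simp
  note [measurable] = borel_measurable_continuous_onI[OF continuous_on_inverse_transform[OF h]]
  let ?F = "\<lambda>t. (iexp (-(t * a)) - iexp (-(t * b))) / (\<i> * t)"
  have F_bound: "cmod (?F t * h t) \<le> (b - a) * \<bar>h t\<bar>" for t
  proof (cases "t = 0")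
    case False
    then have "cmod (?F t) \<le> b - a"
      using Levy_Inversion_aux2[of "-b" "-a" t] ab by simp
    from mult_right_mono[OF this, of "\<bar>h t\<bar>"] show ?thesis
      by (simp only: norm_mult norm_of_real)
  qed (use ab in simp)
  have Fint: "integrable lborel (\<lambda>t. ?F t * h t)"
    by (rule Bochner_Integration.integrable_bound[of _ "\<lambda>t. (b - a) * \<bar>h t\<bar>"])
      (use h F_bound ab in auto)
  have "(\<lambda>T. CLBINT t=-real T..real T. ?F t * h t) \<longlonglongrightarrow> (CLBINT t. ?F t * h t)"
  proof -
    have "(\<lambda>T. CLBINT t. indicator {- real T<..<real T} t *\<^sub>R (?F t * h t))
        \<longlonglongrightarrow> (CLBINT t. ?F t * h t)"
    proof (rule integral_dominated_convergence[where w="\<lambda>t. (b - a) * \<bar>h t\<bar>"])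
      show "AE t in lborel. (\<lambda>T. indicator {- real T<..<real T} t *\<^sub>R (?F t * h t)) \<longlonglongrightarrow> ?F t * h t"
      proof (rule AE_I2, rule tendsto_eventually)
        fix t :: real
        obtain N :: nat where "\<bar>t\<bar> < N" using reals_Archimedean2 by blast
        then show "\<forall>\<^sub>F T in sequentially. indicator {- real T<..<real T} t *\<^sub>R (?F t * h t) = ?F t * h t"
          by (intro eventually_sequentiallyI[of N]) (auto simp: indicator_def abs_less_iff)
      qed
      fix T
      show "AE t in lborel. norm (indicator {- real T<..<real T} t *\<^sub>R (?F t * h t)) \<le> (b - a) * \<bar>h t\<bar>"
        using F_bound ab by (auto simp: indicator_def intro!: AE_I2)
    qed (use h in auto)
    then show ?thesis
      by (simp add: interval_lebesgue_integral_def set_lebesgue_integral_def)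
  qed
  then have "(\<lambda>T. 1 / (2 * pi) * (CLBINT t=-real T..real T. ?F t * h t))
      \<longlonglongrightarrow> 1 / (2 * pi) * (CLBINT t. ?F t * h t)"
    by (intro tendsto_intros)
  with M.Levy_Inversion[OF ab atoms]
  have "complex_of_real (measure M {a<..b}) = 1 / (2 * pi) * (CLBINT t. ?F t * h t)"
    unfolding char of_int_minus of_int_of_nat_eq by (rule LIMSEQ_unique)
  then have "measure M {a<..b} = Re (complex_of_real (1 / (2 * pi)) * (CLBINT t. ?F t * h t))"
    by (metis Re_complex_of_real)
  also have "\<dots> = Re (CLBINT t. ?F t * h t) / (2 * pi)"
    by simp
  also have "Re (CLBINT t. ?F t * h t) = (LBINT t. Re (?F t * h t))"
    using integral_Re[OF Fint] by simp
  also have "\<dots> = (LBINT t. LBINT x. indicator {a..b} x * (h t * cos (t * x)))"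
  proof (rule integral_cong_AE)
    show "AE t in lborel. Re (?F t * h t) = (LBINT x. indicator {a..b} x * (h t * cos (t * x)))"
    proof (rule AE_mp[OF AE_lborel_singleton[of 0]], rule AE_I2, rule impI)
      fix t :: real assume t: "t \<noteq> 0"
      have I: "(LBINT x. (h t * cos (t * x)) * indicator {a..b} x)
          = h t * sin (t * b) / t - h t * sin (t * a) / t"
      proof (rule integral_FTC_Icc_real)
        fix x
        show "((\<lambda>x. h t * sin (t * x) / t) has_real_derivative h t * cos (t * x)) (at x)"
          using t by (auto intro!: derivative_eq_intros)
      qed (use ab in \<open>auto intro!: continuous_intros\<close>)
      have "Re (?F t) = sin (t * b) / t - sin (t * a) / t"
        using t by (simp add: Re_divide Re_exp Im_exp power2_eq_square field_simps)
      moreover have "Re (z * complex_of_real r) = r * Re z" for z r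
        by simp
      ultimately have "Re (?F t * h t) = h t * (sin (t * b) / t - sin (t * a) / t)"
        by (simp only:)
      also have "\<dots> = (LBINT x. (h t * cos (t * x)) * indicator {a..b} x)"
        unfolding I by (simp add: right_diff_distrib)
      also have "\<dots> = (LBINT x. indicator {a..b} x * (h t * cos (t * x)))"
        by (simp add: mult.commute)
      finally show "Re (?F t * h t) = (LBINT x. indicator {a..b} x * (h t * cos (t * x)))" .
    qed
  qed measurable
  also have "\<dots> = (LBINT x. LBINT t. indicator {a..b} x * (h t * cos (t * x)))"
  proof (rule lborel_pair.Fubini_integral[symmetric])
    have ind: "integrable lborel (\<lambda>x. indicat_real {a..b} x)"
      by (simp add: integrable_indicator_iff emeasure_lborel_Icc_eq)
    have one: "integrable lborel (\<lambda>x. indicator {a..b} x * (h t * cos (t * x)))" for t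
      by (rule Bochner_Integration.integrable_bound[of _ "\<lambda>x. indicator {a..b} x * \<bar>h t\<bar>"])
        (use ind in \<open>auto simp: abs_mult indicator_def intro!: mult_left_le\<close>)
    show "integrable (lborel \<Otimes>\<^sub>M lborel) (\<lambda>(t, x). indicator {a..b} x * (h t * cos (t * x)))"
    proof (rule lborel_pair.Fubini_integrable)
      show "integrable lborel (\<lambda>t. LBINT x. norm (case (t, x) of (t, x) \<Rightarrow> indicator {a..b} x * (h t * cos (t * x))))"
      proof (rule Bochner_Integration.integrable_bound[of _ "\<lambda>t. (b - a) * \<bar>h t\<bar>"], goal_cases)
        case 3
        have "(LBINT x. \<bar>indicator {a..b} x * (h t * cos (t * x))\<bar>) \<le> (LBINT x. indicator {a..b} x * \<bar>h t\<bar>)" for t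
          by (intro integral_mono integrable_abs one integrable_mult_left ind)
            (auto simp: abs_mult indicator_def intro!: mult_left_le)
        then show ?case
          using ab by (auto intro!: AE_I2)
      qed (use h in auto)
    qed (use one in auto)
  qed
  also have "\<dots> = (LBINT x. indicator {a..b} x * (2 * pi * inverse_transform h x))"
    by (simp add: inverse_transform_def)
  also have "\<dots> / (2 * pi) = (LBINT x:{a..b}. inverse_transform h x)"
  proof -
    have "(LBINT x. indicator {a..b} x * (2 * pi * inverse_transform h x))
        = (LBINT x. 2 * pi * (indicator {a..b} x * inverse_transform h x))"
      by (rule Bochner_Integration.integral_cong) auto
    also have "\<dots> = 2 * pi * (LBINT x. indicator {a..b} x * inverse_transform h x)"
      by (rule integral_mult_right_zero)
    finally show ?thesis
      by (simp add: set_lebesgue_integral_def)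
  qed
  also have "\<dots> = integral {a..b} (inverse_transform h)"
    by (intro set_borel_integral_eq_integral(2) borel_integrable_atLeastAtMost'
        continuous_on_subset[OF continuous_on_inverse_transform[OF h]]) auto
  finally show ?thesis .
qed

text \<open>
  Levy's formula speaks of intervals whose end points are not atoms. Such points are dense, and the measure
  of the intervals between them is bounded by a multiple of their length; hence there are no atoms at all
  and the formula holds on every interval. The distribution function is then a monotone antiderivative of
  the inverse transform, which gives nonnegativity as well as the density.
\<close>

lemma density_if_integrable_char:
  fixes h :: "real \<Rightarrow> real"
  assumes "real_distribution M" and char: "\<And>t. char M t = complex_of_real (h t)"
    and h: "integrable lborel h"
  shows "\<And>x. 0 \<le> inverse_transform h x" 
    "M = density lborel (\<lambda>x. ennreal (inverse_transform h x))"
proof -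
  let ?p = "inverse_transform h"
  interpret M: real_distribution M by fact
  note cont = continuous_on_inverse_transform[OF h]
  note [measurable] = borel_measurable_continuous_onI[OF cont]
  note Ioc_nonatom = measure_Ioc_eq_integral_inverse_transform[OF assms]
  define C where "C = (\<integral>t. \<bar>h t\<bar> \<partial>lborel) / (2 * pi)"
  note pC = abs_inverse_transform_le[OF h, folded C_def]
  have pint: "?p integrable_on {a..b}" for a b
    by (intro integrable_continuous_real continuous_on_subset[OF cont]) auto
  have "C \<ge> 0" using pC[of 0] by linarith
  have integral_le: "integral {a..b} ?p \<le> C * (b - a)" if "a \<le> b" for a b
  proof -
    have "integral {a..b} ?p \<le> integral {a..b} (\<lambda>_. C)"
      using pC by (intro integral_le pint) (auto simp: abs_le_iff)
    then show ?thesis using that by (simp add: mult.commute)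
  qed
  have atomless: "measure M {x} = 0" for x
  proof (rule antisym[OF field_le_epsilon])
    fix e :: real assume e: "0 < e"
    \<comment> \<open>An interval of length at most \<open>2 d\<close> has measure at most \<open>2 d C\<close>, which is below \<open>e\<close>.\<close>
    define d where "d = e / (2 * (C + 1))"
    have d: "d > 0" using e \<open>C \<ge> 0\<close> by (simp add: d_def)
    obtain a where a: "a \<in> {x - d<..<x}" "measure M {a} = 0"
      using open_minus_countable[OF M.countable_support, of "{x - d<..<x}"] d by auto
    obtain b where b: "b \<in> {x<..<x + d}" "measure M {b} = 0"
      using open_minus_countable[OF M.countable_support, of "{x<..<x + d}"] d by auto
    have "measure M {x} \<le> measure M {a<..b}"
      using a b by (intro M.finite_measure_mono) auto
    also have "\<dots> \<le> C * (b - a)"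
      using a b by (subst Ioc_nonatom) (auto intro!: integral_le)
    also have "\<dots> \<le> (C + 1) * (2 * d)"
      using a b \<open>C \<ge> 0\<close> by (intro mult_mono) auto
    also have "\<dots> = 0 + e" using \<open>C \<ge> 0\<close> by (simp add: d_def field_simps)
    finally show "measure M {x} \<le> 0 + e" .
  qed simp
  have cdf: "cdf M b = cdf M a + integral {a..b} ?p" if "a \<le> b" for a b
    using that Ioc_nonatom[OF that atomless atomless] M.cdf_diff_eq[of a b]
    by (cases "a = b") auto
  have cdf_deriv: "(cdf M has_real_derivative ?p x) (at x)" for x
  proof -
    have "((\<lambda>y. cdf M (x - 1) + integral {x - 1..y} ?p) has_real_derivative 0 + ?p x)
        (at x within {x - 1..x + 1})"
      by (intro DERIV_add DERIV_const integral_has_real_derivative continuous_on_subset[OF cont]) auto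
    then have "(cdf M has_real_derivative 0 + ?p x) (at x within {x - 1..x + 1})"
      by (rule has_field_derivative_transform_within[where d=1]) (auto intro!: cdf[symmetric])
    then show ?thesis by (simp add: at_within_Icc_at)
  qed
  show p0: "0 \<le> ?p x" for x
  proof (rule ccontr)
    assume "\<not> 0 \<le> ?p x"
    then obtain d where d: "d > 0" "\<And>h. 0 < h \<Longrightarrow> h < d \<Longrightarrow> cdf M (x + h) < cdf M x"
      using DERIV_neg_dec_right[OF cdf_deriv[of x]] by auto
    have "cdf M (x + d / 2) < cdf M x" using d by auto
    with M.cdf_nondecreasing[of x "x + d / 2"] d show False by auto
  qed
  have borel_Ioc: "sets borel = sigma_sets UNIV (range (\<lambda>(a, b). {a<..b::real}))"
    by (subst borel_sigma_sets_Ioc) (rule sets_measure_of, simp)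
  show "M = density lborel (\<lambda>x. ennreal (?p x))"
  proof (rule measure_eqI_generator_eq[where E="range (\<lambda>(a, b). {a <.. b::real})" and \<Omega>=UNIV
        and A="\<lambda>n. {- real n<..real n}"])
    show "Int_stable (range (\<lambda>(a, b). {a <.. b::real}))"
    proof (rule Int_stableI, safe)
      fix a b c d :: real
      have "{a<..b} \<inter> {c<..d} = (case (max a c, min b d) of (a, b) \<Rightarrow> {a<..b})"
        by auto
      then show "{a<..b} \<inter> {c<..d} \<in> range (\<lambda>(a, b). {a <.. b::real})"
        by (rule range_eqI)
    qed
    show "sets M = sigma_sets UNIV (range (\<lambda>(a, b). {a<..b}))"
      "sets (density lborel (\<lambda>x. ennreal (?p x))) = sigma_sets UNIV (range (\<lambda>(a, b). {a<..b}))"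
      using M.events_eq_borel borel_Ioc by simp_all
    fix X assume "X \<in> range (\<lambda>(a, b). {a <.. b::real})"
    then obtain a b where X: "X = {a<..b}" by auto
    show "emeasure M X = emeasure (density lborel (\<lambda>x. ennreal (?p x))) X"
    proof (cases "a \<le> b")
      case True
      have "emeasure (density lborel (\<lambda>x. ennreal (?p x))) {a<..b}
          = (\<integral>\<^sup>+x. ennreal (?p x) * indicator {a<..b} x \<partial>lborel)"
        by (simp add: emeasure_density)
      also have "\<dots> = (\<integral>\<^sup>+x. ennreal (?p x) * indicator {a..b} x \<partial>lborel)"
        by (rule nn_integral_cong_AE, rule AE_mp[OF AE_lborel_singleton[of a]], rule AE_I2)
          (auto simp: indicator_def)
      also have "\<dots> = ennreal (cdf M b - cdf M a)"
        by (rule nn_integral_FTC_Icc) (simp, rule cdf_deriv, rule p0, rule True)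
      also have "\<dots> = emeasure M {a<..b}"
        using True M.cdf_diff_eq[of a b] by (cases "a = b") (auto simp: M.emeasure_eq_measure)
      finally show ?thesis using X by simp
    qed (simp add: X)
  next
    show "(\<Union>n. {- real n<..real n}) = UNIV" by (rule UN_Ioc_eq_UNIV)
    show "range (\<lambda>n. {- real n<..real n}) \<subseteq> range (\<lambda>(a, b). {a<..b::real})"
      by auto
  qed simp_all
qed

text \<open>
  Two continuous functions differ on an open set, and a nonempty open set is not a null set. This makes the
  continuous version of a density unique.
\<close>

lemma continuous_eq_if_AE_eq:
  fixes p q :: "real \<Rightarrow> real"
  assumes "continuous_on UNIV p" "continuous_on UNIV q" "AE x in lborel. p x = q x"
  shows "p = q"
proof (rule ccontr)
  assume "p \<noteq> q"
  then obtain x where "p x \<noteq> q x" by auto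
  have op: "open {x. p x \<noteq> q x}"
    using assms by (intro open_Collect_neq) auto
  have "{x. p x \<noteq> q x} \<in> null_sets lborel"
    using assms(3) op by (simp add: AE_iff_null_sets[of "{x. p x \<noteq> q x}"])
  then have "negligible {x. p x \<noteq> q x}"
    by (simp add: negligible_iff_null_sets null_sets_completionI)
  with op \<open>p x \<noteq> q x\<close> show False
    using open_not_negligible by blast
qed

section \<open>The peak of the symmetric stable density\<close>

text \<open>
  On the half-line, the substitution \<open>t = (2 s)\<^sup>1\<^sup>/\<^sup>\<alpha>\<close> turns the integrand into the one that defines
  \<open>\<Gamma>(1/\<alpha>)\<close>.
\<close>

lemma has_bochner_integral_exp_powr:
  fixes \<alpha> :: real
  assumes \<alpha>: "0 < \<alpha>"
  shows "has_bochner_integral lborel (\<lambda>t. exp (- (\<bar>t\<bar> powr \<alpha>) / 2))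
    (2 powr (1 + 1 / \<alpha>) * Gamma (1 / \<alpha>) / \<alpha>)"
proof -
  let ?f = "\<lambda>t::real. exp (- (t powr \<alpha>) / 2)"
  define c where "c = 2 powr (1 / \<alpha>) / \<alpha>"
  have c: "c > 0" using \<alpha> by (simp add: c_def)
  let ?g = "\<lambda>s. (2 * s) powr (1 / \<alpha>)" and ?g' = "\<lambda>s. 2 / \<alpha> * (2 * s) powr (1 / \<alpha> - 1)"
  let ?G = "\<lambda>s. c * (s powr (1 / \<alpha> - 1) / exp s)"
  have fg: "?f (?g s) * ?g' s = ?G s" if "s > 0" for s
  proof -
    have "2 powr (1 / \<alpha> - 1) * 2 = (2::real) powr (1 / \<alpha>)"
      by (simp add: powr_diff)
    then show ?thesis
      using that \<alpha> by (simp add: powr_powr powr_mult c_def exp_minus field_simps)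
  qed
  have "has_bochner_integral lborel (\<lambda>t. indicator {0..} t * t powr (1 / \<alpha> - 1) / exp t) (Gamma (1 / \<alpha>))"
    by (rule has_bochner_integral_nn_integral)
      (use \<alpha> in \<open>auto simp: Gamma_conv_nn_integral_real[symmetric] less_imp_le\<close>)
  then have "has_bochner_integral lborel
      (\<lambda>t. c * (indicator {0..} t * t powr (1 / \<alpha> - 1) / exp t)) (c * Gamma (1 / \<alpha>))"
    by (rule has_bochner_integral_mult_right) 
  also have "?this \<longleftrightarrow> has_bochner_integral lborel (\<lambda>t. indicator {0<..} t *\<^sub>R ?G t) (c * Gamma (1 / \<alpha>))"
    by (rule has_bochner_integral_cong_AE, simp, simp, rule AE_mp[OF AE_lborel_singleton[of 0]], rule AE_I2)
      (auto simp: indicator_def)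
  finally have G: "has_bochner_integral lborel (\<lambda>t. indicator {0<..} t *\<^sub>R ?G t) (c * Gamma (1 / \<alpha>))" .
  also have "(\<lambda>t. indicator {0<..} t *\<^sub>R ?G t) = (\<lambda>t. indicator {0<..} t *\<^sub>R (?f (?g t) * ?g' t))"
  proof
    fix t :: real
    show "indicator {0<..} t *\<^sub>R ?G t = indicator {0<..} t *\<^sub>R (?f (?g t) * ?g' t)"
    proof (cases "0 < t")
      case True
      show ?thesis by (subst fg[OF True]) (rule refl)
    qed simp
  qed
  finally have fgG: "has_bochner_integral lborel
      (\<lambda>t. indicator {0<..} t *\<^sub>R (?f (?g t) * ?g' t)) (c * Gamma (1 / \<alpha>))" .
  have ein: "einterval (ereal 0) \<infinity> = {0<..}"
    by (auto simp: einterval_def)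
  have deriv: "DERIV ?g x :> ?g' x" and contf: "isCont ?f (?g x)" and contg': "isCont ?g' x"
    if "ereal 0 < ereal x" for x
    using that \<alpha> by (auto intro!: derivative_eq_intros continuous_intros)
  have g'_nonneg: "0 \<le> ?g' x" for x
    using \<alpha> by simp
  have "((\<lambda>s. (2 * s) powr (1 / \<alpha>)) \<longlongrightarrow> 0) (at_right 0)" "filterlim ?g at_top at_top"
    using \<alpha> by real_asymp+
  then have lim_0: "((ereal \<circ> ?g \<circ> real_of_ereal) \<longlongrightarrow> ereal 0) (at_right (ereal 0))"
    and lim_inf: "((ereal \<circ> ?g \<circ> real_of_ereal) \<longlongrightarrow> \<infinity>) (at_left \<infinity>)"
    by (simp_all only: ereal_tendsto_simps1 ereal_tendsto_simps2)
  have int: "set_integrable lborel (einterval (ereal 0) \<infinity>) (\<lambda>x. ?f (?g x) * ?g' x)"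
    using fgG by (simp only: ein set_integrable_def has_bochner_integral_iff)
  note subst = interval_integral_substitution_nonneg[of "ereal 0" \<infinity> ?g ?g' ?f "ereal 0" \<infinity>,
      OF _ deriv contf contg' _ g'_nonneg lim_0 lim_inf int]
  have "has_bochner_integral lborel (\<lambda>t. indicator {0<..} t *\<^sub>R ?f t) (c * Gamma (1 / \<alpha>))"
    using subst fgG
    by (simp only: ein set_integrable_def has_bochner_integral_iff interval_lebesgue_integral_def
        set_lebesgue_integral_def) simp
  also have "?this \<longleftrightarrow> has_bochner_integral lborel
      (\<lambda>t. indicator {0..} t *\<^sub>R exp (- (\<bar>t\<bar> powr \<alpha>) / 2)) (c * Gamma (1 / \<alpha>))"
    by (rule has_bochner_integral_cong_AE, simp, simp, rule AE_mp[OF AE_lborel_singleton[of 0]], rule AE_I2)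
      (auto simp: indicator_def)
  finally have "has_bochner_integral lborel (\<lambda>t. exp (- (\<bar>t\<bar> powr \<alpha>) / 2)) (2 *\<^sub>R (c * Gamma (1 / \<alpha>)))"
    by (rule has_bochner_integral_even_function) simp
  also have "2 *\<^sub>R (c * Gamma (1 / \<alpha>)) = 2 powr (1 + 1 / \<alpha>) * Gamma (1 / \<alpha>) / \<alpha>"
    by (simp add: c_def powr_add)
  finally show ?thesis .
qed

text \<open>
  The closed form of \<open>p\<^sub>\<alpha>(0)\<close>.
\<close>

definition stable_peak :: "real \<Rightarrow> real" where
  "stable_peak \<alpha> = 2 powr (1 / \<alpha>) * Gamma (1 / \<alpha>) / (pi * \<alpha>)"

lemma stable_peak_pos: "0 < \<alpha> \<Longrightarrow> 0 < stable_peak \<alpha>"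
  by (simp add: stable_peak_def)

lemma C0_eq: "0 < \<alpha> \<Longrightarrow> C0 \<alpha> = sqrt (2 * pi) * stable_peak \<alpha>"
proof -
  have "2 powr (1 / 2 + 1 / \<alpha>) = sqrt 2 * 2 powr (1 / \<alpha>)"
    by (subst powr_add) (simp add: powr_half_sqrt)
  moreover obtain s where s: "s = sqrt pi" "s > 0" "pi = s * s"
    by simp
  ultimately show ?thesis
    by (simp add: C0_def stable_peak_def real_sqrt_mult flip: s(1)) (simp add: s(2,3))
qed

lemma has_bochner_integral_scaled_exp_powr:
  assumes \<alpha>: "0 < \<alpha>" and l: "0 < l"
  shows "has_bochner_integral lborel (\<lambda>t. exp (- (1 / 2) * (\<bar>t\<bar> powr \<alpha> * l)))
    (2 * pi * (stable_peak \<alpha> / l powr (1 / \<alpha>)))"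
proof -
  have "has_bochner_integral lborel (\<lambda>t. exp (- (\<bar>0 + l powr (1 / \<alpha>) * t\<bar> powr \<alpha>) / 2))
      ((2 powr (1 + 1 / \<alpha>) * Gamma (1 / \<alpha>) / \<alpha>) /\<^sub>R \<bar>l powr (1 / \<alpha>)\<bar>)"
    using has_bochner_integral_exp_powr[OF \<alpha>] l
    by (subst (asm) lborel_has_bochner_integral_real_affine_iff[where c="l powr (1 / \<alpha>)" and t=0])
      simp_all
  also have "(\<lambda>t. exp (- (\<bar>0 + l powr (1 / \<alpha>) * t\<bar> powr \<alpha>) / 2))
      = (\<lambda>t. exp (- (1 / 2) * (\<bar>t\<bar> powr \<alpha> * l)))"
    using \<alpha> l by (simp add: abs_mult powr_mult powr_powr mult.commute)
  also have "(2 powr (1 + 1 / \<alpha>) * Gamma (1 / \<alpha>) / \<alpha>) /\<^sub>R \<bar>l powr (1 / \<alpha>)\<bar>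
      = 2 * pi * (stable_peak \<alpha> / l powr (1 / \<alpha>))"
    by (simp add: stable_peak_def powr_add divide_inverse)
  finally show ?thesis .
qed

text \<open>
  The density is given by a definite description, which needs existence and uniqueness. Both are taken from
  a distribution \<open>M\<close> with the stable characteristic function: its inverse transform is a continuous density,
  and any other continuous density agrees with it almost everywhere, hence everywhere.
\<close>

lemma stable_density_0:
  assumes \<alpha>: "0 < \<alpha>" and M: "real_distribution M"
    and char: "\<And>t. char M t = complex_of_real (exp (- (\<bar>t\<bar> powr \<alpha>) / 2))"
  shows "stable_density \<alpha> 0 = stable_peak \<alpha>"
proof -
  let ?h = "\<lambda>t. exp (- (\<bar>t\<bar> powr \<alpha>) / 2)"
  let ?p = "inverse_transform ?h"
  have h: "integrable lborel ?h"
    using has_bochner_integral_exp_powr[OF \<alpha>] by (simp add: has_bochner_integral_iff)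
  note cont = continuous_on_inverse_transform[OF h]
  note p = density_if_integrable_char[OF M char h]
  have "stable_density \<alpha> = ?p"
    unfolding stable_density_def
  proof (rule the_equality)
    show "is_stable_density \<alpha> ?p"
      using M char p cont by (simp add: is_stable_density_def flip: p(2))
  next
    fix q assume q: "is_stable_density \<alpha> q"
    then have contq: "continuous_on UNIV q" and q0: "\<And>x. 0 \<le> q x"
      by (simp_all add: is_stable_density_def)
    have "density lborel (\<lambda>x. ennreal (q x)) = density lborel (\<lambda>x. ennreal (?p x))"
      using density_if_integrable_char(2)[OF _ _ h, of "density lborel (\<lambda>x. ennreal (q x))"] q
      by (simp add: is_stable_density_def)
    moreover have "(\<lambda>x. ennreal (q x)) \<in> borel_measurable lborel" "(\<lambda>x. ennreal (?p x)) \<in> borel_measurable lborel"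
      using borel_measurable_continuous_onI[OF contq] borel_measurable_continuous_onI[OF cont]
      by simp_all
    ultimately have "AE x in lborel. ennreal (q x) = ennreal (?p x)"
      by (simp add: sigma_finite_measure.density_unique_iff[OF lborel.sigma_finite_measure_axioms])
    then have "AE x in lborel. q x = ?p x"
      by eventually_elim (use q0 p in simp)
    then show "q = ?p"
      by (rule continuous_eq_if_AE_eq[OF contq cont])
  qed
  then show ?thesis
    using has_bochner_integral_exp_powr[OF \<alpha>]
    by (simp add: inverse_transform_def stable_peak_def has_bochner_integral_iff powr_add)
qed

section \<open>Stable measures of balls through finitely many coordinates\<close>

text \<open>
  A coordinate is the scalar product with a unit vector.
\<close>

lemma continuous_on_coord: "continuous_on UNIV (\<lambda>x. coord x i)"
proof -
  define e where "e = Abs_ell2 (\<lambda>j. if j = i then 1 else 0)"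
  have e: "coord e = (\<lambda>j. if j = i then 1 else 0)"
    unfolding e_def by (rule Abs_ell2_inverse) (auto intro!: summable_finite[of "{i}"] split: if_splits)
  have "coord x i = inner x e" for x
    unfolding inner_ell2_def e by (subst suminf_finite[of "{i}"]) auto
  then show ?thesis by (simp add: continuous_intros)
qed

lemma borel_measurable_coord:
  "sets \<mu> = sets borel \<Longrightarrow> (\<lambda>x. coord x i) \<in> borel_measurable \<mu>"
  by (subst measurable_cong_sets[OF _ refl]) (auto intro: borel_measurable_continuous_onI continuous_on_coord)

lemma abs_coord_le_norm: "\<bar>coord x i\<bar> \<le> norm x"
proof -
  have "(coord x i)\<^sup>2 = (\<Sum>j\<in>{i}. coord x j * coord x j)"
    by (simp add: power2_eq_square)
  also have "\<dots> \<le> (\<Sum>j. coord x j * coord x j)"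
    by (rule sum_le_suminf) (auto intro: summable_coord_mult)
  finally show ?thesis
    unfolding norm_ell2_def inner_ell2_def by (simp add: real_le_rsqrt)
qed

lemma L2_set_coord_le_norm: "L2_set (coord x) {..<n} \<le> norm x"
proof -
  have "(\<Sum>j<n. (coord x j)\<^sup>2) \<le> (\<Sum>j. coord x j * coord x j)"
    unfolding power2_eq_square by (rule sum_le_suminf) (auto intro: summable_coord_mult)
  then show ?thesis
    unfolding norm_ell2_def inner_ell2_def L2_set_def by simp
qed

lemma abs_coord_le_sup_norm: "\<bar>coord x i\<bar> \<le> sup_norm x"
  unfolding sup_norm_def
  by (rule cSUP_upper) (auto intro: bdd_aboveI2 abs_coord_le_norm)

definition stable_char :: "ell2 measure \<Rightarrow> real \<Rightarrow> (nat \<Rightarrow> real) \<Rightarrow> bool" where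
  "stable_char \<mu> \<alpha> lam \<longleftrightarrow> (\<forall>y. char_fun \<mu> y =
     complex_of_real (exp (- (1 / 2) * (\<Sum>i. \<bar>coord y i\<bar> powr \<alpha> * lam (Suc i)))))"

text \<open>
  The joint characteristic function of the first \<open>n\<close> coordinates is \<open>char_fun\<close> at the vectors supported on
  \<open>{..<n}\<close>. It factorises, and each factor can be bounded separately without establishing independence of
  the coordinates.
\<close>

lemma joint_char_coords:
  assumes char: "stable_char \<mu> \<alpha> lam"
  shows "(CLINT x|\<mu>. iexp (\<Sum>i<n. t i * coord x i))
    = (\<Prod>i<n. complex_of_real (exp (- (1 / 2) * (\<bar>t i\<bar> powr \<alpha> * lam (Suc i)))))"
proof -
  define y where "y = Abs_ell2 (\<lambda>i. if i < n then t i else 0)"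
  have y: "coord y = (\<lambda>i. if i < n then t i else 0)"
    unfolding y_def by (rule Abs_ell2_inverse) (auto intro!: summable_finite[of "{..<n}"] split: if_splits)
  have "inner x y = (\<Sum>i<n. t i * coord x i)" for x
    unfolding inner_ell2_def y by (subst suminf_finite[of "{..<n}"]) (auto intro!: sum.cong)
  then have "(CLINT x|\<mu>. iexp (\<Sum>i<n. t i * coord x i)) = char_fun \<mu> y"
    by (simp add: char_fun_def)
  also have "\<dots> = complex_of_real (exp (- (1 / 2) * (\<Sum>i. \<bar>coord y i\<bar> powr \<alpha> * lam (Suc i))))"
    using char by (simp add: stable_char_def)
  also have "(\<Sum>i. \<bar>coord y i\<bar> powr \<alpha> * lam (Suc i)) = (\<Sum>i<n. \<bar>t i\<bar> powr \<alpha> * lam (Suc i))"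
    unfolding y by (subst suminf_finite[of "{..<n}"]) (auto intro!: sum.cong)
  also have "exp (- (1 / 2) * (\<Sum>i<n. \<bar>t i\<bar> powr \<alpha> * lam (Suc i)))
      = (\<Prod>i<n. exp (- (1 / 2) * (\<bar>t i\<bar> powr \<alpha> * lam (Suc i))))"
    by (simp only: sum_distrib_left exp_sum finite_lessThan)
  finally show ?thesis by simp
qed

lemma stable_density_0_if_stable_char:
  assumes \<mu>: "prob_space \<mu>" "sets \<mu> = sets borel" and \<alpha>: "0 < \<alpha>"
    and char: "stable_char \<mu> \<alpha> lam" and l: "0 < lam 1"
  shows "stable_density \<alpha> 0 = stable_peak \<alpha>"
proof (rule stable_density_0[OF \<alpha>])
  interpret prob_space \<mu> by fact
  note [measurable] = borel_measurable_coord[OF \<mu>(2)]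
  let ?Y = "\<lambda>x. coord x 0 / lam 1 powr (1 / \<alpha>)"
  show "real_distribution (distr \<mu> borel ?Y)"
    by (rule real_distribution_distr) simp
  fix t
  have "Characteristic_Functions.char (distr \<mu> borel ?Y) t = (CLINT x|\<mu>. iexp (t * ?Y x))"
    unfolding char_def by (rule integral_distr) auto
  also have "\<dots> = (CLINT x|\<mu>. iexp (\<Sum>i<Suc 0. t / lam 1 powr (1 / \<alpha>) * coord x i))"
    by simp
  also have "\<dots> = complex_of_real (exp (- (1 / 2) * (\<bar>t / lam 1 powr (1 / \<alpha>)\<bar> powr \<alpha> * lam 1)))"
    by (subst joint_char_coords[OF char]) simp
  also have "\<bar>t / lam 1 powr (1 / \<alpha>)\<bar> powr \<alpha> * lam 1 = \<bar>t\<bar> powr \<alpha>"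
    using l \<alpha> by (simp add: abs_divide powr_divide powr_powr)
  finally show "Characteristic_Functions.char (distr \<mu> borel ?Y) t = complex_of_real (exp (- (\<bar>t\<bar> powr \<alpha>) / 2))"
    by simp
qed

text \<open>
  Each factor of the joint characteristic function contributes
  \<open>(\<integral> exp (- \<bar>t\<bar>\<^sup>\<alpha> \<lambda>\<^sub>i / 2) dt) / (2 \<pi>) = p\<^sub>\<alpha>(0) / \<lambda>\<^sub>i\<^sup>1\<^sup>/\<^sup>\<alpha>\<close>, the peak of the density of
  coordinate \<open>i\<close>.
\<close>

lemma emeasure_coords_le:
  assumes \<mu>: "prob_space \<mu>" "sets \<mu> = sets borel" and \<alpha>: "0 < \<alpha>"
    and char: "stable_char \<mu> \<alpha> lam" and l: "\<And>i. i < n \<Longrightarrow> 0 < lam (Suc i)"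
    and AB: "A \<in> sets (Pi\<^sub>M {..<n} (\<lambda>_. lborel))" "B \<in> sets (Pi\<^sub>M {..<n} (\<lambda>_. lborel))" "0 < \<delta>"
      "\<And>x y. x \<in> A \<Longrightarrow> y \<in> space (Pi\<^sub>M {..<n} (\<lambda>_. lborel)) \<Longrightarrow>
        (\<And>i. i < n \<Longrightarrow> \<bar>x i - y i\<bar> \<le> \<delta>) \<Longrightarrow> y \<in> B"
  shows "emeasure \<mu> {x. (\<lambda>i\<in>{..<n}. coord x i) \<in> A}
    \<le> ennreal (\<Prod>i<n. stable_peak \<alpha> / lam (Suc i) powr (1 / \<alpha>)) * emeasure (Pi\<^sub>M {..<n} (\<lambda>_. lborel)) B"
proof -
  let ?f = "\<lambda>i t. exp (- (1 / 2) * (\<bar>t\<bar> powr \<alpha> * lam (Suc i)))"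
  have f: "has_bochner_integral lborel (?f i) (2 * pi * (stable_peak \<alpha> / lam (Suc i) powr (1 / \<alpha>)))"
    if "i < n" for i
    using has_bochner_integral_scaled_exp_powr[OF \<alpha> l[OF that]] .
  have "emeasure \<mu> {x \<in> space \<mu>. (\<lambda>i\<in>{..<n}. coord x i) \<in> A}
      \<le> ennreal (\<Prod>i<n. (\<integral>t. ?f i t \<partial>lborel) / (2 * pi)) * emeasure (Pi\<^sub>M {..<n} (\<lambda>_. lborel)) B"
  proof (rule joint_density_bound[OF \<mu>(1) _ _ joint_char_coords[OF char]])
    show "integrable lborel (?f i)" if "i \<in> {..<n}" for i
      using f[of i] that by (simp add: has_bochner_integral_iff)
    show "?f i t \<le> 1" if "i \<in> {..<n}" for i t
      using l[of i] that by (simp add: less_imp_le)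
  qed (use AB borel_measurable_coord[OF \<mu>(2)] in auto)
  also have "(\<Prod>i<n. (\<integral>t. ?f i t \<partial>lborel) / (2 * pi)) = (\<Prod>i<n. stable_peak \<alpha> / lam (Suc i) powr (1 / \<alpha>))"
    using f by (intro prod.cong) (auto simp: has_bochner_integral_iff)
  finally show ?thesis
    using sets_eq_imp_space_eq[OF \<mu>(2)] by (simp only: space_borel UNIV_I simp_thms)
qed

text \<open>
  The ball lies in the cylinder over a cube of side \<open>2 r\<close>. Enlarging the cube by \<open>\<delta>\<close> on each side leaves the
  room that the density bound asks for; then \<open>\<delta>\<close> tends to 0.
\<close>

lemma measure_D_ball_le:
  assumes \<mu>: "prob_space \<mu>" "sets \<mu> = sets borel" and \<alpha>: "0 < \<alpha>"
    and char: "stable_char \<mu> \<alpha> lam" and l: "\<And>i. i < n \<Longrightarrow> 0 < lam (Suc i)" and r: "0 < r"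
  shows "measure \<mu> (D_ball r) \<le> (\<Prod>i<n. stable_peak \<alpha> / lam (Suc i) powr (1 / \<alpha>)) * (2 * r) ^ n"
    (is "_ \<le> ?c * _")
proof -
  interpret prob_space \<mu> by fact
  interpret L: product_sigma_finite "\<lambda>_::nat. lborel :: real measure" by unfold_locales
  note [measurable] = borel_measurable_coord[OF \<mu>(2)]
  have c: "?c \<ge> 0"
    using stable_peak_pos[OF \<alpha>] by (intro prod_nonneg) auto
  let ?A = "Pi\<^sub>E {..<n} (\<lambda>_. {- r..r})"
  have bound: "measure \<mu> (D_ball r) \<le> ?c * (2 * (r + \<delta>)) ^ n" if \<delta>: "0 < \<delta>" for \<delta> :: real
  proof -
    let ?B = "Pi\<^sub>E {..<n} (\<lambda>_. {- (r + \<delta>)..r + \<delta>})"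
    have "emeasure \<mu> {x. (\<lambda>i\<in>{..<n}. coord x i) \<in> ?A}
        \<le> ennreal ?c * emeasure (Pi\<^sub>M {..<n} (\<lambda>_. lborel)) ?B"
    proof (rule emeasure_coords_le[OF assms(1-5) _ _ \<delta>])
      fix x y :: "nat \<Rightarrow> real"
      assume "x \<in> ?A" and y: "y \<in> space (Pi\<^sub>M {..<n} (\<lambda>_. lborel))"
        and d: "\<And>i. i < n \<Longrightarrow> \<bar>x i - y i\<bar> \<le> \<delta>"
      then have "- r \<le> x i \<and> x i \<le> r" if "i < n" for i
        using that by (auto simp: PiE_iff)
      then have "- (r + \<delta>) \<le> y i \<and> y i \<le> r + \<delta>" if "i < n" for i
        using d[OF that] that by (smt (verit))
      then show "y \<in> ?B"
        using y by (auto simp: space_PiM PiE_iff)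
    qed (auto intro!: sets_PiM_I_finite)
    also have "emeasure (Pi\<^sub>M {..<n} (\<lambda>_. lborel)) ?B = (\<Prod>i<n. ennreal (2 * (r + \<delta>)))"
      using r \<delta> by (subst L.emeasure_PiM) (auto simp: emeasure_lborel_Icc_eq)
    also have "\<dots> = ennreal ((2 * (r + \<delta>)) ^ n)"
      using r \<delta> by (simp add: ennreal_power del: ennreal_plus)
    also have "ennreal ?c * \<dots> = ennreal (?c * (2 * (r + \<delta>)) ^ n)"
      using c r \<delta> by (simp add: ennreal_mult)
    finally have "measure \<mu> {x. (\<lambda>i\<in>{..<n}. coord x i) \<in> ?A} \<le> ?c * (2 * (r + \<delta>)) ^ n"
      unfolding emeasure_eq_measure
      by (rule ennreal_le_iff[THEN iffD1, rotated]) (use c r \<delta> in simp)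
    moreover have "measure \<mu> (D_ball r) \<le> measure \<mu> {x. (\<lambda>i\<in>{..<n}. coord x i) \<in> ?A}"
    proof (rule finite_measure_mono)
      have "coord x i \<in> {- r..r}" if "sup_norm x \<le> r" for x i
        using order_trans[OF abs_coord_le_sup_norm that, of i] by (auto simp: abs_le_iff)
      then show "D_ball r \<subseteq> {x. (\<lambda>i\<in>{..<n}. coord x i) \<in> ?A}"
        by (auto simp: D_ball_def PiE_iff)
      have "{x \<in> space \<mu>. (\<lambda>i\<in>{..<n}. coord x i) \<in> ?A} \<in> events"
        by measurable
      then show "{x. (\<lambda>i\<in>{..<n}. coord x i) \<in> ?A} \<in> events"
        using sets_eq_imp_space_eq[OF \<mu>(2)] by simp
    qed
    ultimately show ?thesis by linarith
  qed
  have "((\<lambda>\<delta>. ?c * (2 * (r + \<delta>)) ^ n) \<longlongrightarrow> ?c * (2 * (r + 0)) ^ n) (at_right 0)"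
    by (intro tendsto_intros)
  then show ?thesis
    using bound by (intro tendsto_lowerbound[of _ _ "at_right 0"]) (auto simp: eventually_at_filter)
qed

text \<open>
  The same with a Euclidean ball in place of the cube. A shift of each of the \<open>n\<close> coordinates by at most
  \<open>\<delta>\<close> changes the Euclidean norm by at most \<open>n \<delta>\<close>.
\<close>

lemma measure_S_ball_le:
  assumes \<mu>: "prob_space \<mu>" "sets \<mu> = sets borel" and \<alpha>: "0 < \<alpha>"
    and char: "stable_char \<mu> \<alpha> lam" and l: "\<And>i. i < n \<Longrightarrow> 0 < lam (Suc i)" and r: "0 < r"
  shows "measure \<mu> (S_ball r)
    \<le> (\<Prod>i<n. stable_peak \<alpha> / lam (Suc i) powr (1 / \<alpha>)) * (unit_ball_vol (real n) * r ^ n)"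
    (is "_ \<le> ?c * _")
proof -
  interpret prob_space \<mu> by fact
  note [measurable] = borel_measurable_coord[OF \<mu>(2)]
  have c: "?c \<ge> 0"
    using stable_peak_pos[OF \<alpha>] by (intro prod_nonneg) auto
  let ?L = "Pi\<^sub>M {..<n} (\<lambda>_. lborel :: real measure)"
  let ?B = "\<lambda>r. {f. sqrt (\<Sum>i<n. (f i)\<^sup>2) \<le> r} \<inter> space ?L"
  have B: "?B r \<in> sets ?L" for r
  proof -
    have "{f \<in> space ?L. sqrt (\<Sum>i<n. (f i)\<^sup>2) \<le> r} \<in> sets ?L" by measurable
    then show ?thesis by (simp add: Collect_conj_eq Int_commute)
  qed
  have bound: "measure \<mu> (S_ball r) \<le> ?c * (unit_ball_vol (real n) * (r + real n * \<delta>) ^ n)" if \<delta>: "0 < \<delta>" for \<delta> :: real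
  proof -
    have "emeasure \<mu> {x. (\<lambda>i\<in>{..<n}. coord x i) \<in> ?B r} \<le> ennreal ?c * emeasure ?L (?B (r + real n * \<delta>))"
    proof (rule emeasure_coords_le[OF assms(1-5) B[of r] B[of "r + real n * \<delta>"] \<delta>])
      fix x y :: "nat \<Rightarrow> real"
      assume x: "x \<in> ?B r" and y: "y \<in> space ?L" and d: "\<And>i. i < n \<Longrightarrow> \<bar>x i - y i\<bar> \<le> \<delta>"
      have "L2_set y {..<n} \<le> L2_set x {..<n} + L2_set (\<lambda>i. y i - x i) {..<n}"
        using L2_set_triangle_ineq[of x "\<lambda>i. y i - x i" "{..<n}"] by simp
      also have "L2_set (\<lambda>i. y i - x i) {..<n} \<le> (\<Sum>i<n. \<bar>y i - x i\<bar>)"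
        by (rule L2_set_le_sum_abs)
      also have "\<dots> \<le> (\<Sum>i<n. \<delta>)"
        using d by (intro sum_mono) (auto simp: abs_minus_commute)
      finally show "y \<in> ?B (r + real n * \<delta>)"
        using x y by (simp add: L2_set_def)
    qed
    also have "emeasure ?L (?B (r + real n * \<delta>)) = ennreal (unit_ball_vol (real n) * (r + real n * \<delta>) ^ n)"
      using emeasure_cball_aux[of "{..<n}" "r + real n * \<delta>"] r \<delta> by (simp add: add_pos_nonneg)
    also have "ennreal ?c * \<dots> = ennreal (?c * (unit_ball_vol (real n) * (r + real n * \<delta>) ^ n))"
      using c r \<delta> by (simp add: ennreal_mult)
    finally have "measure \<mu> {x. (\<lambda>i\<in>{..<n}. coord x i) \<in> ?B r} \<le> ?c * (unit_ball_vol (real n) * (r + real n * \<delta>) ^ n)"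
      unfolding emeasure_eq_measure
      by (rule ennreal_le_iff[THEN iffD1, rotated]) (use c r \<delta> in simp)
    moreover have "measure \<mu> (S_ball r) \<le> measure \<mu> {x. (\<lambda>i\<in>{..<n}. coord x i) \<in> ?B r}"
    proof (rule finite_measure_mono)
      have "(\<lambda>i\<in>{..<n}. coord x i) \<in> ?B r" if "norm x \<le> r" for x
        using order_trans[OF L2_set_coord_le_norm[of x n] that] by (simp add: L2_set_def space_PiM)
      then show "S_ball r \<subseteq> {x. (\<lambda>i\<in>{..<n}. coord x i) \<in> ?B r}"
        by (auto simp: S_ball_def)
      have "(\<lambda>x. \<lambda>i\<in>{..<n}. coord x i) \<in> measurable \<mu> ?L"
        by (rule measurable_restrict) simp
      then have "(\<lambda>x. \<lambda>i\<in>{..<n}. coord x i) -` ?B r \<inter> space \<mu> \<in> events"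
        by (rule measurable_sets[OF _ B])
      then show "{x. (\<lambda>i\<in>{..<n}. coord x i) \<in> ?B r} \<in> events"
        using sets_eq_imp_space_eq[OF \<mu>(2)] by (simp add: vimage_def)
    qed
    ultimately show ?thesis by linarith
  qed
  have "((\<lambda>\<delta>. ?c * (unit_ball_vol (real n) * (r + real n * \<delta>) ^ n))
      \<longlongrightarrow> ?c * (unit_ball_vol (real n) * (r + real n * 0) ^ n)) (at_right 0)"
    by (intro tendsto_intros)
  then show ?thesis
    using bound by (intro tendsto_lowerbound[of _ _ "at_right 0"]) (auto simp: eventually_at_filter)
qed

section \<open>A lower bound for the Gamma function at half-integers\<close>

lemma ln_antiderivative:
  fixes a b :: real
  assumes "0 < a" "a \<le> b"
  shows "(ln has_integral (b * ln b - b) - (a * ln a - a)) {a..b}"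
proof (rule fundamental_theorem_of_calculus[OF assms(2)])
  fix x assume x: "x \<in> {a..b}"
  then have "((\<lambda>x. x * ln x - x) has_real_derivative ln x) (at x within {a..b})"
    using assms by (auto intro!: derivative_eq_intros)
  then show "((\<lambda>x. x * ln x - x) has_vector_derivative ln x) (at x within {a..b})"
    by (simp add: has_real_derivative_iff_has_vector_derivative)
qed

text \<open>
  The midpoint rule overestimates the integral of the concave function \<open>ln\<close>: integrate the tangent at \<open>u\<close>
  over the interval of length 1 centred at \<open>u\<close>.
\<close>

lemma ln_midpoint_bound:
  fixes u :: real
  assumes "1/2 < u"
  shows "((u+1/2) * ln (u+1/2) - (u+1/2)) - ((u-1/2) * ln (u-1/2) - (u-1/2)) \<le> ln u"
proof -
  let ?T = "\<lambda>x::real. (ln u - 1) * x + x\<^sup>2 / (2 * u)"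
  have "((\<lambda>x. ln u + (x - u) / u) has_integral ?T (u+1/2) - ?T (u-1/2)) {u-1/2..u+1/2}"
  proof (rule fundamental_theorem_of_calculus)
    fix x
    have "(?T has_real_derivative (ln u + (x - u) / u)) (at x within {u-1/2..u+1/2})"
      using assms by (auto intro!: derivative_eq_intros simp: diff_divide_distrib)
    then show "(?T has_vector_derivative ln u + (x - u) / u) (at x within {u-1/2..u+1/2})"
      by (simp add: has_real_derivative_iff_has_vector_derivative)
  qed simp
  note 1 = this
  have 2: "(ln has_integral ((u+1/2) * ln (u+1/2) - (u+1/2)) - ((u-1/2) * ln (u-1/2) - (u-1/2)))
      {u-1/2..u+1/2}"
    using assms by (intro ln_antiderivative) auto
  have 3: "ln x \<le> ln u + (x - u) / u" if "x \<in> {u-1/2..u+1/2}" for x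
  proof -
    have "x > 0" "u > 0" using that assms by auto
    then have "ln x - ln u \<le> x / u - 1"
      using ln_le_minus_one[of "x/u"] by (simp add: ln_div)
    then show ?thesis using \<open>u > 0\<close> by (simp add: diff_divide_distrib)
  qed
  have "((u+1/2) * ln (u+1/2) - (u+1/2)) - ((u-1/2) * ln (u-1/2) - (u-1/2))
      \<le> ?T (u+1/2) - ?T (u-1/2)"
    by (rule has_integral_le[OF 2 1 3])
  also have "\<dots> = (ln u - 1) + ((u+1/2)\<^sup>2 - (u-1/2)\<^sup>2) / (2 * u)"
    by (simp add: diff_divide_distrib right_diff_distrib distrib_left)
  also have "(u+1/2)\<^sup>2 - (u-1/2)\<^sup>2 = 2 * u"
    by (simp add: power2_eq_square algebra_simps)
  also have "(ln u - 1) + 2 * u / (2 * u) = ln u"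
    using assms by simp
  finally show ?thesis .
qed

text \<open>
  Stirling's lower bound in the shifted form \<open>\<Gamma>(x + 1) \<ge> ((x + 1/2) / e)\<^bsup>x + 1/2\<^esup>\<close> with \<open>x = n/2\<close>. The shift by 1/2 makes
  it inductive: passing from \<open>x\<close> to \<open>x + 1\<close> multiplies the left side by \<open>x + 1\<close> and the right side by at
  most that, by the midpoint bound. One step raises \<open>n\<close> by 2, so 0 and 1 are both base cases.
\<close>

lemma Gamma_half_integer_lower:
  "exp ((n/2 + 1/2) * ln (n/2 + 1/2) - (n/2 + 1/2)) \<le> Gamma (real n / 2 + 1)"
proof (induction n rule: less_induct)
  case (less n)
  consider "n = 0" | "n = 1" | m where "n = Suc (Suc m)"
    by (metis One_nat_def not0_implies_Suc)
  then show ?case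
  proof cases
    case 1
    have "(1/2) * ln (1/2::real) - 1/2 \<le> 0"
      using ln_le_zero_iff[of "1/2::real"] by linarith
    with 1 show ?thesis by simp
  next
    case 2
    have "exp (-1::real) \<le> 1/2"
      using exp_ge_add_one_self[of "1::real"] by (simp add: exp_minus field_simps)
    also have "1/2 \<le> sqrt pi / 2"
      using pi_gt3 by simp
    also have "\<dots> = Gamma (3/2::real)"
      using Gamma_plus1[of "1/2::real"] nonpos_Ints_nonpos[of "1/2::real"]
      by (force simp: Gamma_one_half_real)
    finally show ?thesis using 2 by simp
  next
    case (3 m)
    define x where "x = real m / 2"
    have x: "x \<ge> 0" by (simp add: x_def)
    have "exp ((x+3/2) * ln (x+3/2) - (x+3/2))
        \<le> exp (ln (x+1) + ((x+1/2) * ln (x+1/2) - (x+1/2)))"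
      using ln_midpoint_bound[of "x+1"] x by (simp add: algebra_simps)
    also have "\<dots> = (x+1) * exp ((x+1/2) * ln (x+1/2) - (x+1/2))"
      using x by (simp add: exp_add)
    also have "\<dots> \<le> (x+1) * Gamma (x + 1)"
      using less[of m] x 3 by (intro mult_left_mono) (auto simp: x_def)
    also have "\<dots> = Gamma (x + 2)"
      using x Gamma_plus1[of "x+1"] by (simp add: nonpos_Ints_def add.commute)
    finally have "exp ((x+3/2) * ln (x+3/2) - (x+3/2)) \<le> Gamma (x + 2)" .
    moreover have "real n / 2 + 1 / 2 = x + 3 / 2" "real n / 2 + 1 = x + 2"
      by (simp_all add: 3 x_def field_simps)
    ultimately show ?thesis
      by (simp only:)
  qed
qed

text \<open>
  Without the shift inside the logarithm, the main terms are those of half the integral of \<open>ln\<close> over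
  \<open>[1, n]\<close>, against which the bound is used.
\<close>

lemma ln_Gamma_half_integer_lower:
  assumes "n \<ge> 1"
  shows "ln (Gamma (real n / 2 + 1)) \<ge> (n/2 + 1/2) * ln (n/2) - n/2 - 1/2"
proof -
  have "(n/2 + 1/2) * ln (n/2) - n/2 - 1/2 \<le> (n/2 + 1/2) * ln (n/2 + 1/2) - (n/2 + 1/2)"
    using assms mult_left_mono[of "ln (n/2)" "ln (n/2 + 1/2)" "n/2+1/2"] by simp
  also have "\<dots> \<le> ln (Gamma (real n / 2 + 1))"
    using Gamma_half_integer_lower[of n] Gamma_real_pos[of "real n/2+1"]
    by (simp add: ln_ge_iff del: Gamma_real_pos)
  finally show ?thesis .
qed

section \<open>Sums, integrals and logarithmic slopes\<close>

text \<open>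
  Up to the boundary term, \<open>x f'(x) / f(x)\<close> is the part of the derivative of \<open>x ln (f x)\<close> that is not
  \<open>ln (f x)\<close>. The integral is a gauge integral, so the derivative of \<open>f\<close> need not be continuous for the
  fundamental theorem of calculus to apply.
\<close>

lemma log_slope_integral_by_parts:
  assumes f: "f differentiable_on {1..}" and pos: "\<And>x. 1 \<le> x \<Longrightarrow> 0 < f x" and y: "1 \<le> y"
  shows "log_slope_integral f y = y * ln (f y) - ln (f 1) - integral {1..y} (\<lambda>x. ln (f x))"
proof -
  let ?d = "\<lambda>x. vector_derivative f (at x within {1..})"
  have cont: "continuous_on {1..y} (\<lambda>x. ln (f x))"
  proof -
    have "continuous_on {1..y} f"
      using differentiable_imp_continuous_on[OF f] by (rule continuous_on_subset) auto
    then show ?thesis using pos by (intro continuous_on_ln) force+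
  qed
  have "((\<lambda>x. ln (f x) + x * ?d x / f x) has_integral y * ln (f y) - 1 * ln (f 1)) {1..y}"
  proof (rule fundamental_theorem_of_calculus[OF y])
    fix x assume x: "x \<in> {1..y}"
    have "(f has_vector_derivative ?d x) (at x within {1..})"
      using f x by (auto simp: differentiable_on_def vector_derivative_works[symmetric])
    then have "(f has_real_derivative ?d x) (at x within {1..y})"
      by (auto simp: has_real_derivative_iff_has_vector_derivative
          intro: has_vector_derivative_within_subset)
    then have "((\<lambda>x. x * ln (f x)) has_real_derivative ln (f x) + x * ?d x / f x)
        (at x within {1..y})"
      using pos[of x] x by (auto intro!: derivative_eq_intros)
    then show "((\<lambda>x. x * ln (f x)) has_vector_derivative ln (f x) + x * ?d x / f x)
        (at x within {1..y})"
      by (simp add: has_real_derivative_iff_has_vector_derivative)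
  qed
  moreover have "((\<lambda>x. ln (f x)) has_integral integral {1..y} (\<lambda>x. ln (f x))) {1..y}"
    using integrable_continuous_real[OF cont] by (simp add: integrable_integral)
  ultimately have "((\<lambda>x. (ln (f x) + x * ?d x / f x) - ln (f x)) has_integral
      (y * ln (f y) - 1 * ln (f 1)) - integral {1..y} (\<lambda>x. ln (f x))) {1..y}"
    by (rule has_integral_diff)
  then show ?thesis
    unfolding log_slope_integral_def by (intro integral_unique) simp
qed

text \<open>
  The left end points of the unit intervals give a lower Riemann sum of \<open>n - 1\<close> terms; the term \<open>g n\<close> is left
  over.
\<close>

lemma sum_le_integral_mono:
  fixes g :: "real \<Rightarrow> real"
  assumes mono: "mono_on {1..} g" and cont: "continuous_on {1..} g" and n: "1 \<le> n"
  shows "(\<Sum>i=1..n. g (real i)) \<le> integral {1..real n} g + g n"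
  using n
proof (induction n rule: nat_induct_at_least)
  case base
  then show ?case by simp
next
  case (Suc n)
  have int: "g integrable_on {a..b}" if "1 \<le> a" for a b
    using that by (intro integrable_continuous_real continuous_on_subset[OF cont]) auto
  have "g n = integral {real n..real (Suc n)} (\<lambda>_. g n)"
    by simp
  also have "\<dots> \<le> integral {real n..real (Suc n)} g"
    using Suc.hyps by (intro integral_le int integrable_const_ivl monotone_onD[OF mono]) auto
  finally have "g n \<le> integral {real n..real (Suc n)} g" .
  moreover have "integral {1..real n} g + integral {real n..real (Suc n)} g
      = integral {1..real (Suc n)} g"
    using Suc.hyps by (intro Henstock_Kurzweil_Integration.integral_combine int) auto
  ultimately show ?case using Suc.IH by simp
qed

text \<open>
  A concave function lies above its chords, so the trapezoidal rule underestimates the integral.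
\<close>

lemma sum_le_integral_concave:
  fixes g :: "real \<Rightarrow> real"
  assumes conc: "convex_on {1..} (\<lambda>x. - g x)" and cont: "continuous_on {1..} g" and n: "1 \<le> n"
  shows "(\<Sum>i=1..n. g (real i)) \<le> integral {1..real n} g + (g 1 + g n) / 2"
  using n
proof (induction n rule: nat_induct_at_least)
  case base
  then show ?case by simp
next
  case (Suc n)
  have int: "g integrable_on {a..b}" if "1 \<le> a" for a b
    using that by (intro integrable_continuous_real continuous_on_subset[OF cont]) auto
  let ?n = "real n" and ?m = "real n + 1"
  \<comment> \<open>The chord over \<open>[n, n + 1]\<close> and an antiderivative of it.\<close>
  let ?L = "\<lambda>x. g ?n + (x - ?n) * (g ?m - g ?n)"
  let ?P = "\<lambda>x. g ?n * x + (x - ?n)\<^sup>2 / 2 * (g ?m - g ?n)"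
  have "(?L has_integral ?P ?m - ?P ?n) {?n..?m}"
  proof (rule fundamental_theorem_of_calculus)
    fix x
    have "(?P has_real_derivative ?L x) (at x within {?n..?m})"
      by (auto intro!: derivative_eq_intros)
    then show "(?P has_vector_derivative ?L x) (at x within {?n..?m})"
      by (simp add: has_real_derivative_iff_has_vector_derivative)
  qed simp
  then have L: "(?L has_integral (g ?n + g ?m) / 2) {?n..?m}"
    by (simp add: field_simps)
  moreover have "(g has_integral integral {?n..?m} g) {?n..?m}"
    using int[of ?n ?m] Suc.hyps by (simp add: integrable_integral)
  moreover have "?L x \<le> g x" if x: "x \<in> {?n..?m}" for x
  proof -
    have "- g ((1 - (x - ?n)) *\<^sub>R ?n + (x - ?n) *\<^sub>R ?m)
        \<le> (1 - (x - ?n)) * - g ?n + (x - ?n) * - g ?m"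
      using x Suc.hyps by (intro convex_onD[OF conc]) auto
    moreover have "(1 - (x - ?n)) *\<^sub>R ?n + (x - ?n) *\<^sub>R ?m = x"
      by (simp add: algebra_simps)
    ultimately show ?thesis by (simp add: algebra_simps)
  qed
  ultimately have "(g ?n + g ?m) / 2 \<le> integral {?n..?m} g"
    by (rule has_integral_le)
  moreover have "integral {1..?n} g + integral {?n..?m} g = integral {1..?m} g"
    using Suc.hyps by (intro Henstock_Kurzweil_Integration.integral_combine int) auto
  ultimately show ?case using Suc.IH by (simp add: add.commute field_simps)
qed

text \<open>
  The choice of \<open>n\<close> enters the small ball estimates only through these two consequences of
  \<open>\<epsilon> f(n) \<le> 1\<close>: the main term \<open>n ln (\<epsilon> f(n))\<close> left by integration by parts is nonpositive, and the error of
  the comparison of sum and integral is controlled by \<open>- ln \<epsilon>\<close>.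
\<close>

lemma log_slope_bound:
  assumes f: "f differentiable_on {1..}" and pos: "\<And>x. 1 \<le> x \<Longrightarrow> 0 < f x"
    and n: "1 \<le> n" and \<epsilon>: "0 < \<epsilon>" "\<epsilon> * f (real n) \<le> 1"
  shows "real n * ln \<epsilon> + integral {1..real n} (\<lambda>x. ln (f x)) \<le> - log_slope_integral f n - ln (f 1)"
    and "ln (f n) \<le> - ln \<epsilon>"
proof -
  have "ln \<epsilon> + ln (f n) = ln (\<epsilon> * f n)"
    using \<epsilon>(1) pos[of n] n by (simp add: ln_mult)
  also have "\<dots> \<le> 0"
    using \<epsilon> pos[of n] n by (simp add: ln_le_zero_iff)
  finally have le: "ln \<epsilon> + ln (f n) \<le> 0" .
  then show "ln (f n) \<le> - ln \<epsilon>" by simp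
  have "real n * (ln \<epsilon> + ln (f n)) \<le> 0"
    using le by (simp add: mult_nonneg_nonpos)
  then show "real n * ln \<epsilon> + integral {1..real n} (\<lambda>x. ln (f x)) \<le> - log_slope_integral f n - ln (f 1)"
    using log_slope_integral_by_parts[OF f pos, of "real n"] n by (simp add: distrib_left)
qed

lemma continuous_on_ln_profile:
  fixes \<sigma> :: "real \<Rightarrow> real"
  assumes "\<sigma> differentiable_on {1..}" "\<And>x. 1 \<le> x \<Longrightarrow> 0 < \<sigma> x"
  shows "continuous_on {1..} (\<lambda>x. - ln (\<sigma> x))"
  using assms by (intro continuous_intros differentiable_imp_continuous_on) force+

lemma sum_ln_profile_le:
  fixes \<sigma> :: "real \<Rightarrow> real"
  assumes "\<sigma> differentiable_on {1..}" and pos: "\<And>x. 1 \<le> x \<Longrightarrow> 0 < \<sigma> x" and anti: "antimono_on {1..} \<sigma>"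
    and n: "1 \<le> n"
  shows "(\<Sum>i=1..n. - ln (\<sigma> (real i))) \<le> integral {1..real n} (\<lambda>x. - ln (\<sigma> x)) - ln (\<sigma> n)"
    and "convex_on {1..} (\<lambda>x. ln (\<sigma> x)) \<Longrightarrow>
      (\<Sum>i=1..n. - ln (\<sigma> (real i))) \<le> integral {1..real n} (\<lambda>x. - ln (\<sigma> x)) - (ln (\<sigma> 1) + ln (\<sigma> n)) / 2"
proof -
  note cont = continuous_on_ln_profile[OF assms(1) pos]
  have "mono_on {1..} (\<lambda>x. - ln (\<sigma> x))"
    using pos monotone_onD[OF anti] by (intro monotone_onI) auto
  from sum_le_integral_mono[OF this cont n]
  show "(\<Sum>i=1..n. - ln (\<sigma> (real i))) \<le> integral {1..real n} (\<lambda>x. - ln (\<sigma> x)) - ln (\<sigma> n)"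
    by simp
  assume "convex_on {1..} (\<lambda>x. ln (\<sigma> x))"
  then have "convex_on {1..} (\<lambda>x. - (- ln (\<sigma> x)))" by simp
  from sum_le_integral_concave[OF this cont n]
  show "(\<Sum>i=1..n. - ln (\<sigma> (real i))) \<le> integral {1..real n} (\<lambda>x. - ln (\<sigma> x)) - (ln (\<sigma> 1) + ln (\<sigma> n)) / 2"
    by (simp add: field_simps)
qed

text \<open>
  Both \<open>\<phi>\<close> and \<open>\<Psi>\<close> are constants divided by \<open>\<sigma>\<close> times an explicit factor, so the integrals of their
  logarithms reduce to that of \<open>- ln \<sigma>\<close>, the function to which the comparison with sums applies.
\<close>

lemma integral_ln_quotient:
  fixes \<sigma> :: "real \<Rightarrow> real"
  assumes "\<sigma> differentiable_on {1..}" and pos: "\<And>x. 1 \<le> x \<Longrightarrow> 0 < \<sigma> x" and c: "0 < c" and y: "1 \<le> y"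
  shows "integral {1..y} (\<lambda>x. ln (c / \<sigma> x)) = (y - 1) * ln c + integral {1..y} (\<lambda>x. - ln (\<sigma> x))"
    and "integral {1..y} (\<lambda>x. ln (c / (\<sigma> x * sqrt x)))
      = (y - 1) * ln c + integral {1..y} (\<lambda>x. - ln (\<sigma> x)) - (y * ln y - y + 1) / 2"
proof -
  have "(\<lambda>x. - ln (\<sigma> x)) integrable_on {1..y}"
    using continuous_on_ln_profile[OF assms(1) pos]
    by (intro integrable_continuous_real) (auto intro: continuous_on_subset)
  then have g: "((\<lambda>x. - ln (\<sigma> x)) has_integral integral {1..y} (\<lambda>x. - ln (\<sigma> x))) {1..y}"
    by (rule integrable_integral)
  have c': "((\<lambda>_. ln c) has_integral (y - 1) * ln c) {1..y}"
    using has_integral_const_real[of "ln c" 1 y] y by simp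
  from has_integral_add[OF c' g]
  have h: "((\<lambda>x. ln c + - ln (\<sigma> x)) has_integral (y - 1) * ln c + integral {1..y} (\<lambda>x. - ln (\<sigma> x))) {1..y}" .
  have nz: "\<sigma> x \<noteq> 0" if "1 \<le> x" for x
    using pos[OF that] by simp
  have "((\<lambda>x. ln (c / \<sigma> x)) has_integral (y - 1) * ln c + integral {1..y} (\<lambda>x. - ln (\<sigma> x))) {1..y}"
    by (rule has_integral_eq[OF _ h]) (use nz c in \<open>simp add: ln_div\<close>)
  then show "integral {1..y} (\<lambda>x. ln (c / \<sigma> x)) = (y - 1) * ln c + integral {1..y} (\<lambda>x. - ln (\<sigma> x))"
    by (rule integral_unique)
  have "((\<lambda>x. ln x * (1 / 2)) has_integral ((y * ln y - y) - (1 * ln 1 - 1)) * (1 / 2)) {1..y}"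
    using y by (intro has_integral_mult_left ln_antiderivative) auto
  from has_integral_diff[OF h this]
  have "((\<lambda>x. ln (c / (\<sigma> x * sqrt x))) has_integral
      (y - 1) * ln c + integral {1..y} (\<lambda>x. - ln (\<sigma> x)) - ((y * ln y - y) - (1 * ln 1 - 1)) * (1 / 2)) {1..y}"
    by (rule has_integral_eq[rotated]) (use nz c in \<open>simp add: ln_div ln_mult ln_sqrt\<close>)
  then show "integral {1..y} (\<lambda>x. ln (c / (\<sigma> x * sqrt x)))
      = (y - 1) * ln c + integral {1..y} (\<lambda>x. - ln (\<sigma> x)) - (y * ln y - y + 1) / 2"
    by (subst integral_unique) simp_all
qed

text \<open>
  Stirling's bound in the formula \<open>\<pi>\<^bsup>n/2\<^esup> / \<Gamma>(n/2 + 1)\<close>; the additive constant 1 is \<open>1/2 + ln 2 / 2\<close> rounded up.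
\<close>

lemma ln_unit_ball_vol_le:
  assumes n: "1 \<le> n"
  shows "ln (unit_ball_vol (real n)) \<le> n / 2 * ln (2 * pi) - (n / 2 + 1 / 2) * ln n + n / 2 + 1"
proof -
  have "0 < Gamma (real n / 2 + 1)"
    by (rule Gamma_real_pos) simp
  then have "Gamma (real n / 2 + 1) \<noteq> 0"
    by (rule less_imp_neq[symmetric])
  then have "ln (unit_ball_vol (real n)) = n / 2 * ln pi - ln (Gamma (real n / 2 + 1))"
    unfolding unit_ball_vol_def by (subst ln_div) (auto simp: ln_powr)
  also have "\<dots> \<le> n / 2 * ln pi - ((n / 2 + 1 / 2) * ln (n / 2) - n / 2 - 1 / 2)"
    using ln_Gamma_half_integer_lower[OF n] by simp
  also have "ln (real n / 2) = ln n - ln 2"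
    using n by (simp add: ln_div)
  also have "n / 2 * ln pi - ((n / 2 + 1 / 2) * (ln n - ln 2) - n / 2 - 1 / 2)
      = n / 2 * ln (2 * pi) - (n / 2 + 1 / 2) * ln n + n / 2 + 1 / 2 + ln 2 / 2"
    by (simp add: ln_mult algebra_simps)
  also have "\<dots> \<le> n / 2 * ln (2 * pi) - (n / 2 + 1 / 2) * ln n + n / 2 + 1"
    using ln_2_less_1 by simp
  finally show ?thesis .
qed

lemma prod_eq_exp_sum_ln:
  assumes "\<And>i. i < n \<Longrightarrow> 0 < (a (Suc i) :: real)"
  shows "(\<Prod>i<n. a (Suc i)) = exp (\<Sum>i=1..n. ln (a i))"
proof -
  have "(\<Prod>i<n. a (Suc i)) = (\<Prod>i<n. exp (ln (a (Suc i))))"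
    using assms by (intro prod.cong) auto
  also have "\<dots> = exp (\<Sum>i<n. ln (a (Suc i)))"
    by (simp add: exp_sum)
  also have "(\<Sum>i<n. ln (a (Suc i))) = (\<Sum>i=1..n. ln (a i))"
    by (simp add: sum.atLeast1_atMost_eq)
  finally show ?thesis .
qed

section \<open>The small ball estimates\<close>

text \<open>
  The bound by the product of the \<open>\<epsilon> \<phi>(i)\<close> in logarithmic form. The term \<open>ln \<phi>(1)\<close> is kept: it is the only
  one that depends on \<open>\<sigma>\<close> apart from \<open>H\<close>, and \<open>\<sigma>(1)\<close> is bounded in terms of \<open>\<lambda>\<^sub>1\<close>.
\<close>

lemma D_ball_bounds:
  fixes \<sigma> :: "real \<Rightarrow> real"
  assumes \<mu>: "prob_space \<mu>" "sets \<mu> = sets borel" and \<alpha>: "0 < \<alpha>" and char: "stable_char \<mu> \<alpha> lam"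
    and pos: "\<And>x. 1 \<le> x \<Longrightarrow> 0 < \<sigma> x" and diff: "\<sigma> differentiable_on {1..}" and anti: "antimono_on {1..} \<sigma>"
    and lam: "\<And>i. 1 \<le> i \<Longrightarrow> 0 < lam i" "\<And>i. 1 \<le> i \<Longrightarrow> \<sigma> (real i) \<le> lam i powr (1 / \<alpha>)"
    and n: "1 \<le> n" and \<epsilon>: "0 < \<epsilon>" "\<epsilon> * phi \<alpha> \<sigma> (real n) \<le> 1"
  shows "measure \<mu> (D_ball \<epsilon>) \<le> exp (- H \<alpha> \<sigma> (real n) - ln (phi \<alpha> \<sigma> 1) - ln \<epsilon>)"
    and "convex_on {1..} (\<lambda>x. ln (\<sigma> x)) \<Longrightarrow>
      measure \<mu> (D_ball \<epsilon>) \<le> exp (- H \<alpha> \<sigma> (real n) - ln (phi \<alpha> \<sigma> 1) / 2 - ln \<epsilon> / 2)"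
proof -
  define p where "p = stable_peak \<alpha>"
  have p: "0 < p" unfolding p_def by (rule stable_peak_pos[OF \<alpha>])
  have phi: "phi \<alpha> \<sigma> = (\<lambda>x. 2 * p / \<sigma> x)"
    using stable_density_0_if_stable_char[OF \<mu> \<alpha> char] lam(1)[of 1] by (simp add: phi_def fun_eq_iff p_def)
  have phi_pos: "0 < phi \<alpha> \<sigma> x" if "1 \<le> x" for x
    using pos[OF that] p by (simp add: phi)
  have phi_diff: "phi \<alpha> \<sigma> differentiable_on {1..}"
    unfolding phi differentiable_on_def
  proof (rule ballI, rule differentiable_divide)
    fix x :: real assume x: "x \<in> {1..}"
    show "\<sigma> differentiable at x within {1..}" using diff x by (simp add: differentiable_on_def)
    show "\<sigma> x \<noteq> 0" using pos[of x] x by auto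
  qed simp
  have "measure \<mu> (D_ball \<epsilon>) \<le> (\<Prod>i<n. p / lam (Suc i) powr (1 / \<alpha>)) * (2 * \<epsilon>) ^ n"
    unfolding p_def using lam(1) by (intro measure_D_ball_le[OF \<mu> \<alpha> char _ \<epsilon>(1)]) simp
  also have "\<dots> \<le> (\<Prod>i<n. p / \<sigma> (real (Suc i))) * (2 * \<epsilon>) ^ n"
  proof (intro mult_right_mono prod_mono conjI divide_left_mono)
    fix i show "\<sigma> (real (Suc i)) \<le> lam (Suc i) powr (1 / \<alpha>)" by (rule lam(2)) simp
    show "0 < lam (Suc i) powr (1 / \<alpha>) * \<sigma> (real (Suc i))" using lam(1)[of "Suc i"] pos[of "real (Suc i)"] by simp
  qed (use p \<epsilon> in auto)
  also have "\<dots> = (\<Prod>i<n. \<epsilon> * (2 * p / \<sigma> (real (Suc i))))"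
  proof -
    have "(\<Prod>i<n. p / \<sigma> (real (Suc i))) * (2 * \<epsilon>) ^ n = (\<Prod>i<n. p / \<sigma> (real (Suc i)) * (2 * \<epsilon>))"
      by (subst prod.distrib) (simp only: prod_constant card_lessThan)
    also have "\<dots> = (\<Prod>i<n. \<epsilon> * (2 * p / \<sigma> (real (Suc i))))"
      by (rule prod.cong) (simp_all add: mult_ac)
    finally show ?thesis .
  qed
  also have "\<dots> = exp (\<Sum>i=1..n. ln (\<epsilon> * (2 * p / \<sigma> (real i))))"
    using p \<epsilon> pos by (intro prod_eq_exp_sum_ln) auto
  also have "(\<Sum>i=1..n. ln (\<epsilon> * (2 * p / \<sigma> (real i))))
      = n * ln \<epsilon> + (n * ln (2 * p) + (\<Sum>i=1..n. - ln (\<sigma> (real i))))"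
  proof -
    have "ln (\<epsilon> * (2 * p / \<sigma> (real i))) = ln \<epsilon> + (ln (2 * p) + - ln (\<sigma> (real i)))" if "i \<in> {1..n}" for i
      using p \<epsilon> pos[of "real i"] that by (subst ln_mult) (auto simp: ln_div)
    then have "(\<Sum>i=1..n. ln (\<epsilon> * (2 * p / \<sigma> (real i))))
        = (\<Sum>i=1..n. ln \<epsilon> + (ln (2 * p) + - ln (\<sigma> (real i))))"
      by (rule sum.cong[OF refl])
    then show ?thesis
      by (simp only: sum.distrib sum_constant card_atLeastAtMost diff_Suc_1)
  qed
  finally have main: "measure \<mu> (D_ball \<epsilon>)
      \<le> exp (n * ln \<epsilon> + (n * ln (2 * p) + (\<Sum>i=1..n. - ln (\<sigma> (real i)))))" .
  have ln_phi: "ln (phi \<alpha> \<sigma> x) = ln (2 * p) - ln (\<sigma> x)" if "1 \<le> x" for x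
    using pos[OF that] p unfolding phi by (subst ln_div) auto
  have int: "integral {1..real n} (\<lambda>x. ln (phi \<alpha> \<sigma> x))
      = (real n - 1) * ln (2 * p) + integral {1..real n} (\<lambda>x. - ln (\<sigma> x))"
    unfolding phi using integral_ln_quotient(1)[OF diff pos, of "2 * p" "real n"] p n by simp
  note slope = log_slope_bound[OF phi_diff phi_pos n \<epsilon>, folded H_def]
  note ln_n = ln_phi[of "real n"] and ln_1 = ln_phi[of 1]
  have expand: "(real n - 1) * ln (2 * p) = n * ln (2 * p) - ln (2 * p)"
    by (simp add: left_diff_distrib)
  have "n * ln \<epsilon> + (n * ln (2 * p) + (\<Sum>i=1..n. - ln (\<sigma> (real i))))
      \<le> - H \<alpha> \<sigma> (real n) - ln (phi \<alpha> \<sigma> 1) - ln \<epsilon>"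
    using sum_ln_profile_le(1)[OF diff pos anti n] slope int ln_n n expand unfolding H_def by simp
  with main show "measure \<mu> (D_ball \<epsilon>) \<le> exp (- H \<alpha> \<sigma> (real n) - ln (phi \<alpha> \<sigma> 1) - ln \<epsilon>)"
    by (meson order_trans exp_le_cancel_iff)
  assume conv: "convex_on {1..} (\<lambda>x. ln (\<sigma> x))"
  have "n * ln \<epsilon> + (n * ln (2 * p) + (\<Sum>i=1..n. - ln (\<sigma> (real i))))
      \<le> - H \<alpha> \<sigma> (real n) - ln (phi \<alpha> \<sigma> 1) / 2 - ln \<epsilon> / 2"
    using sum_ln_profile_le(2)[OF diff pos anti n conv] slope int ln_n ln_1 n expand unfolding H_def by (simp add: field_simps)
  with main show "measure \<mu> (D_ball \<epsilon>) \<le> exp (- H \<alpha> \<sigma> (real n) - ln (phi \<alpha> \<sigma> 1) / 2 - ln \<epsilon> / 2)"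
    by (meson order_trans exp_le_cancel_iff)
qed

text \<open>
  The logarithm of the volume of the unit ball contributes \<open>- (n/2 + 1/2) ln n + n/2\<close>. All of it except
  \<open>- 1/2 ln n\<close> is, up to a constant, the integral of \<open>- 1/2 ln x\<close> contained in that of \<open>ln \<Psi>\<close>. The powers
  of \<open>2 \<pi>\<close> combine with those of \<open>p\<^sub>\<alpha>(0)\<close> to powers of \<open>C\<^sub>0(\<alpha>)\<close>. The constant 2 in the exponent is
  a generous bound for what remains.
\<close>

lemma S_ball_bounds:
  fixes \<sigma> :: "real \<Rightarrow> real"
  assumes \<mu>: "prob_space \<mu>" "sets \<mu> = sets borel" and \<alpha>: "0 < \<alpha>" and char: "stable_char \<mu> \<alpha> lam"
    and pos: "\<And>x. 1 \<le> x \<Longrightarrow> 0 < \<sigma> x" and diff: "\<sigma> differentiable_on {1..}" and anti: "antimono_on {1..} \<sigma>"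
    and lam: "\<And>i. 1 \<le> i \<Longrightarrow> 0 < lam i" "\<And>i. 1 \<le> i \<Longrightarrow> \<sigma> (real i) \<le> lam i powr (1 / \<alpha>)"
    and n: "1 \<le> n" and \<epsilon>: "0 < \<epsilon>" "\<epsilon> * Psi \<alpha> \<sigma> (real n) \<le> 1"
  shows "measure \<mu> (S_ball \<epsilon>) \<le> exp (- K \<alpha> \<sigma> (real n) - ln (Psi \<alpha> \<sigma> 1) - ln \<epsilon> + 2)"
    and "convex_on {1..} (\<lambda>x. ln (\<sigma> x)) \<Longrightarrow>
      measure \<mu> (S_ball \<epsilon>) \<le> exp (- K \<alpha> \<sigma> (real n) - ln (Psi \<alpha> \<sigma> 1) / 2 - ln (\<epsilon>\<^sup>2 * n) / 4 + 2)"
proof -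
  define p where "p = stable_peak \<alpha>"
  have p: "0 < p" unfolding p_def by (rule stable_peak_pos[OF \<alpha>])
  define c where "c = C0 \<alpha>"
  have c_eq: "c = sqrt (2 * pi) * p" unfolding c_def p_def by (rule C0_eq[OF \<alpha>])
  have c: "0 < c" using p by (simp add: c_eq)
  have ln_c: "ln c = ln (2 * pi) / 2 + ln p"
    unfolding c_eq using p by (subst ln_mult) (auto simp: ln_sqrt)
  have Psi: "Psi \<alpha> \<sigma> = (\<lambda>x. c / (\<sigma> x * sqrt x))"
    by (simp add: Psi_def fun_eq_iff c_def)
  have Psi_pos: "0 < Psi \<alpha> \<sigma> x" if "1 \<le> x" for x
    using pos[OF that] c that by (simp add: Psi)
  have Psi_diff: "Psi \<alpha> \<sigma> differentiable_on {1..}"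
    unfolding Psi differentiable_on_def
  proof (rule ballI, rule differentiable_divide, simp, rule differentiable_mult)
    fix x :: real assume x: "x \<in> {1..}"
    show "\<sigma> differentiable at x within {1..}" using diff x by (simp add: differentiable_on_def)
    have "(sqrt has_real_derivative inverse (sqrt x) / 2) (at x within {1..})"
      using x by (intro DERIV_subset[OF DERIV_real_sqrt]) auto
    then show "sqrt differentiable at x within {1..}"
      by (auto simp: real_differentiable_def)
    show "\<sigma> x * sqrt x \<noteq> 0" using pos[of x] x by auto
  qed
  have "measure \<mu> (S_ball \<epsilon>) \<le> (\<Prod>i<n. p / lam (Suc i) powr (1 / \<alpha>)) * (unit_ball_vol (real n) * \<epsilon> ^ n)"
    unfolding p_def using lam(1) by (intro measure_S_ball_le[OF \<mu> \<alpha> char _ \<epsilon>(1)]) simp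
  also have "\<dots> \<le> (\<Prod>i<n. p / \<sigma> (real (Suc i))) * (unit_ball_vol (real n) * \<epsilon> ^ n)"
  proof (intro mult_right_mono prod_mono conjI divide_left_mono)
    fix i show "\<sigma> (real (Suc i)) \<le> lam (Suc i) powr (1 / \<alpha>)" by (rule lam(2)) simp
    show "0 < lam (Suc i) powr (1 / \<alpha>) * \<sigma> (real (Suc i))" using lam(1)[of "Suc i"] pos[of "real (Suc i)"] by simp
  qed (use p \<epsilon> in auto)
  also have "(\<Prod>i<n. p / \<sigma> (real (Suc i))) = exp (\<Sum>i=1..n. ln (p / \<sigma> (real i)))"
    using p pos by (intro prod_eq_exp_sum_ln) auto
  also have "(\<Sum>i=1..n. ln (p / \<sigma> (real i))) = n * ln p + (\<Sum>i=1..n. - ln (\<sigma> (real i)))"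
  proof -
    have "ln (p / \<sigma> (real i)) = ln p + - ln (\<sigma> (real i))" if "i \<in> {1..n}" for i
      using p pos[of "real i"] that by (subst ln_div) auto
    then have "(\<Sum>i=1..n. ln (p / \<sigma> (real i))) = (\<Sum>i=1..n. ln p + - ln (\<sigma> (real i)))"
      by (rule sum.cong[OF refl])
    then show ?thesis
      by (simp only: sum.distrib sum_constant card_atLeastAtMost diff_Suc_1)
  qed
  also have "unit_ball_vol (real n) * \<epsilon> ^ n = exp (ln (unit_ball_vol (real n)) + n * ln \<epsilon>)"
    using \<epsilon> by (simp add: exp_add exp_of_nat_mult)
  also have "exp (n * ln p + (\<Sum>i=1..n. - ln (\<sigma> (real i)))) * exp (ln (unit_ball_vol (real n)) + n * ln \<epsilon>)
      = exp (n * ln p + (\<Sum>i=1..n. - ln (\<sigma> (real i))) + ln (unit_ball_vol (real n)) + n * ln \<epsilon>)"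
    by (simp only: exp_add[symmetric] add.assoc)
  finally have main: "measure \<mu> (S_ball \<epsilon>)
      \<le> exp (n * ln p + (\<Sum>i=1..n. - ln (\<sigma> (real i))) + ln (unit_ball_vol (real n)) + n * ln \<epsilon>)" .
  have ln_Psi: "ln (Psi \<alpha> \<sigma> x) = ln c - ln (\<sigma> x) - ln x / 2" if "1 \<le> x" for x
    using pos[OF that] c that unfolding Psi by (simp add: ln_div ln_mult ln_sqrt)
  have int: "integral {1..real n} (\<lambda>x. ln (Psi \<alpha> \<sigma> x))
      = (real n - 1) * ln c + integral {1..real n} (\<lambda>x. - ln (\<sigma> x)) - (n * ln n - n + 1) / 2"
    unfolding Psi using integral_ln_quotient(2)[OF diff pos c, of "real n"] n by simp
  have vol: "n * ln p + ln (unit_ball_vol (real n)) \<le> n * ln c - (n / 2 + 1 / 2) * ln n + n / 2 + 1"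
    using ln_unit_ball_vol_le[OF n] by (simp add: ln_c algebra_simps)
  have expand: "(real n - 1) * ln c = n * ln c - ln c"
    "(n / 2 + 1 / 2) * ln n = n * ln n / 2 + ln n / 2"
    by (simp_all add: algebra_simps)
  note slope = log_slope_bound[OF Psi_diff Psi_pos n \<epsilon>, folded K_def]
  note ln_n = ln_Psi[of "real n"] and ln_1 = ln_Psi[of 1]
  have "n * ln p + (\<Sum>i=1..n. - ln (\<sigma> (real i))) + ln (unit_ball_vol (real n)) + n * ln \<epsilon>
      \<le> - K \<alpha> \<sigma> (real n) - ln (Psi \<alpha> \<sigma> 1) - ln \<epsilon> + 2"
    using sum_ln_profile_le(1)[OF diff pos anti n] slope int ln_n n vol unfolding K_def expand by (simp add: field_simps)
  with main show "measure \<mu> (S_ball \<epsilon>) \<le> exp (- K \<alpha> \<sigma> (real n) - ln (Psi \<alpha> \<sigma> 1) - ln \<epsilon> + 2)"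
    by (meson order_trans exp_le_cancel_iff)
  assume conv: "convex_on {1..} (\<lambda>x. ln (\<sigma> x))"
  have "ln (\<epsilon>\<^sup>2 * n) = 2 * ln \<epsilon> + ln n"
    using \<epsilon> n by (simp add: ln_mult ln_realpow)
  then have "n * ln p + (\<Sum>i=1..n. - ln (\<sigma> (real i))) + ln (unit_ball_vol (real n)) + n * ln \<epsilon>
      \<le> - K \<alpha> \<sigma> (real n) - ln (Psi \<alpha> \<sigma> 1) / 2 - ln (\<epsilon>\<^sup>2 * n) / 4 + 2"
    using sum_ln_profile_le(2)[OF diff pos anti n conv] slope int ln_n ln_1 n vol unfolding K_def expand by (simp add: field_simps)
  with main show "measure \<mu> (S_ball \<epsilon>) \<le> exp (- K \<alpha> \<sigma> (real n) - ln (Psi \<alpha> \<sigma> 1) / 2 - ln (\<epsilon>\<^sup>2 * n) / 4 + 2)"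
    by (meson order_trans exp_le_cancel_iff)
qed

lemma le_mult_exp:
  assumes "m \<le> exp a" "0 < C" "a \<le> ln C + b"
  shows "m \<le> (C::real) * exp b"
proof -
  have "m \<le> exp (ln C + b)"
    using assms by (meson order_trans exp_le_cancel_iff)
  then show ?thesis
    using assms by (simp add: exp_add)
qed

theorem proposition1:
  fixes \<alpha> lam1 :: real
  assumes "0 < \<alpha>" and "\<alpha> \<le> 2"
  shows "\<exists>C1>0. \<exists>C2>0. \<exists>C3>0. \<exists>C4>0.
    \<forall>(lam :: nat \<Rightarrow> real) (\<mu> :: ell2 measure) (\<sigma> :: real \<Rightarrow> real)
      (\<nu> :: real \<Rightarrow> nat) (\<eta> :: real \<Rightarrow> nat).
      lam 1 = lam1 \<and>
      (\<forall>i\<ge>1. 0 \<le> lam i) \<and>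
      (\<forall>i\<ge>1. lam (Suc i) \<le> lam i) \<and>
      summable (\<lambda>i. lam (Suc i)) \<and>
      prob_space \<mu> \<and> sets \<mu> = sets borel \<and>
      (\<forall>y. char_fun \<mu> y =
         complex_of_real (exp (- (1 / 2) * (\<Sum>i. \<bar>coord y i\<bar> powr \<alpha> * lam (Suc i))))) \<and>
      (\<forall>x\<ge>1. 0 < \<sigma> x) \<and>
      \<sigma> differentiable_on {1..} \<and>
      antimono_on {1..} \<sigma> \<and>
      (\<forall>n\<ge>1. \<sigma> (real n) \<le> lam n powr (1 / \<alpha>)) \<and>
      (\<forall>\<epsilon>>0. 1 \<le> \<nu> \<epsilon> \<and> 1 \<le> \<eta> \<epsilon>) \<and>
      (\<forall>\<epsilon>. 0 < \<epsilon> \<and> \<epsilon> < inverse (phi \<alpha> \<sigma> 1) \<longrightarrow> \<epsilon> * phi \<alpha> \<sigma> (real (\<nu> \<epsilon>)) \<le> 1) \<and>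
      (\<forall>\<epsilon>. 0 < \<epsilon> \<and> \<epsilon> < inverse (Psi \<alpha> \<sigma> 1) \<longrightarrow> \<epsilon> * Psi \<alpha> \<sigma> (real (\<eta> \<epsilon>)) \<le> 1)
      \<longrightarrow>
      (\<forall>\<epsilon>. 0 < \<epsilon> \<and> \<epsilon> < inverse (max (phi \<alpha> \<sigma> 1) (Psi \<alpha> \<sigma> 1)) \<longrightarrow>
         measure \<mu> (D_ball \<epsilon>) \<le> C1 * exp (- H \<alpha> \<sigma> (real (\<nu> \<epsilon>)) - ln \<epsilon>) \<and>
         measure \<mu> (S_ball \<epsilon>) \<le> C2 * exp (- K \<alpha> \<sigma> (real (\<eta> \<epsilon>)) - ln \<epsilon>) \<and>
         (convex_on {1..} (\<lambda>x. ln (\<sigma> x)) \<longrightarrow>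
            measure \<mu> (D_ball \<epsilon>)
              \<le> C3 * exp (- H \<alpha> \<sigma> (real (\<nu> \<epsilon>)) - 1 / 2 * ln \<epsilon>) \<and>
            measure \<mu> (S_ball \<epsilon>)
              \<le> C4 * exp (- K \<alpha> \<sigma> (real (\<eta> \<epsilon>)) - 1 / 4 * ln (\<epsilon>\<^sup>2 * real (\<eta> \<epsilon>)))))"
proof -
  define c1 where "c1 = 1 + lam1 powr (1 / \<alpha>) / (2 * stable_peak \<alpha>)"
  define c2 where "c2 = 1 + lam1 powr (1 / \<alpha>) / C0 \<alpha>"
  note peak = stable_peak_pos[OF assms(1)]
  have C0: "0 < C0 \<alpha>"
    using peak assms by (simp add: C0_eq)
  have c1: "1 \<le> c1" and c2: "1 \<le> c2"
    using peak C0 by (simp_all add: c1_def c2_def)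
  have bounds: "measure \<mu> (D_ball \<epsilon>) \<le> c1 * exp (- H \<alpha> \<sigma> (real (\<nu> \<epsilon>)) - ln \<epsilon>) \<and>
      measure \<mu> (S_ball \<epsilon>) \<le> exp 2 * c2 * exp (- K \<alpha> \<sigma> (real (\<eta> \<epsilon>)) - ln \<epsilon>) \<and>
      (convex_on {1..} (\<lambda>x. ln (\<sigma> x)) \<longrightarrow>
        measure \<mu> (D_ball \<epsilon>) \<le> c1 * exp (- H \<alpha> \<sigma> (real (\<nu> \<epsilon>)) - 1 / 2 * ln \<epsilon>) \<and>
        measure \<mu> (S_ball \<epsilon>)
          \<le> exp 2 * c2 * exp (- K \<alpha> \<sigma> (real (\<eta> \<epsilon>)) - 1 / 4 * ln (\<epsilon>\<^sup>2 * real (\<eta> \<epsilon>))))"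
    if hyps: "lam 1 = lam1" "prob_space \<mu>" "sets \<mu> = sets borel" "stable_char \<mu> \<alpha> lam"
        "\<forall>i\<ge>1. 0 \<le> lam i"
        "\<forall>x\<ge>1. 0 < \<sigma> x" "\<sigma> differentiable_on {1..}" "antimono_on {1..} \<sigma>"
        "\<forall>n\<ge>1. \<sigma> (real n) \<le> lam n powr (1 / \<alpha>)"
        "\<forall>\<epsilon>>0. 1 \<le> \<nu> \<epsilon> \<and> 1 \<le> \<eta> \<epsilon>"
        "\<forall>\<epsilon>. 0 < \<epsilon> \<and> \<epsilon> < inverse (phi \<alpha> \<sigma> 1) \<longrightarrow> \<epsilon> * phi \<alpha> \<sigma> (real (\<nu> \<epsilon>)) \<le> 1"
        "\<forall>\<epsilon>. 0 < \<epsilon> \<and> \<epsilon> < inverse (Psi \<alpha> \<sigma> 1) \<longrightarrow> \<epsilon> * Psi \<alpha> \<sigma> (real (\<eta> \<epsilon>)) \<le> 1"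
      and \<epsilon>: "0 < \<epsilon>" "\<epsilon> < inverse (max (phi \<alpha> \<sigma> 1) (Psi \<alpha> \<sigma> 1))"
    for lam :: "nat \<Rightarrow> real" and \<mu> :: "ell2 measure" and \<sigma> :: "real \<Rightarrow> real"
      and \<nu> \<eta> :: "real \<Rightarrow> nat" and \<epsilon> :: real
  proof -
    have pos: "0 < \<sigma> x" if "1 \<le> x" for x
      using hyps(6) that by blast
    have dom: "\<sigma> (real i) \<le> lam i powr (1 / \<alpha>)" if "1 \<le> i" for i
      using hyps(9) that by blast
    \<comment> \<open>A vanishing \<open>\<lambda>\<^sub>i\<close> would force \<open>\<sigma>(i) \<le> 0\<close>, because \<open>0 powr a = 0\<close>.\<close>
    have lam_pos: "0 < lam i" if "1 \<le> i" for i
    proof (rule ccontr)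
      assume "\<not> 0 < lam i"
      then have "lam i = 0" using hyps(5) that by force
      then show False using dom[OF that] pos[of "real i"] that by simp
    qed
    have "stable_density \<alpha> 0 = stable_peak \<alpha>"
      using stable_density_0_if_stable_char[OF hyps(2,3) assms(1) hyps(4)] lam_pos[of 1] by simp
    then have phi1: "phi \<alpha> \<sigma> 1 = 2 * stable_peak \<alpha> / \<sigma> 1" and Psi1: "Psi \<alpha> \<sigma> 1 = C0 \<alpha> / \<sigma> 1"
      by (simp_all add: phi_def Psi_def)
    have phi1_pos: "0 < phi \<alpha> \<sigma> 1" and Psi1_pos: "0 < Psi \<alpha> \<sigma> 1"
      using peak C0 pos[of 1] by (simp_all add: phi1 Psi1)
    have \<sigma>1: "\<sigma> 1 \<le> lam1 powr (1 / \<alpha>)"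
      using dom[of 1] hyps(1) by simp
    have "inverse (phi \<alpha> \<sigma> 1) \<le> c1" "inverse (Psi \<alpha> \<sigma> 1) \<le> c2"
      using divide_right_mono[OF \<sigma>1, of "2 * stable_peak \<alpha>"] divide_right_mono[OF \<sigma>1, of "C0 \<alpha>"] peak C0
      by (simp_all add: phi1 Psi1 c1_def c2_def)
    then have ln1: "- ln (phi \<alpha> \<sigma> 1) \<le> ln c1" "- ln (Psi \<alpha> \<sigma> 1) \<le> ln c2"
      using phi1_pos Psi1_pos c1 c2 by (simp_all flip: ln_inverse)
    \<comment> \<open>The summand 1 in \<open>c1\<close> and \<open>c2\<close> makes their logarithms nonnegative, so that the same constants also serve for the convex case, where only half of \<open>- ln \<phi>(1)\<close> and \<open>- ln \<Psi>(1)\<close> occurs.\<close>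
    have "0 \<le> ln c1" "0 \<le> ln c2"
      using c1 c2 by simp_all
    then have ln2: "- ln (phi \<alpha> \<sigma> 1) / 2 \<le> ln c1" "- ln (Psi \<alpha> \<sigma> 1) / 2 \<le> ln c2"
      using ln1 by simp_all
    have ln_c2: "ln (exp 2 * c2) = 2 + ln c2"
      using c2 by (simp add: ln_mult)
    have "\<epsilon> * max (phi \<alpha> \<sigma> 1) (Psi \<alpha> \<sigma> 1) < 1"
      using \<epsilon> phi1_pos by (simp add: inverse_eq_divide pos_less_divide_eq)
    then have "\<epsilon> * phi \<alpha> \<sigma> 1 < 1" "\<epsilon> * Psi \<alpha> \<sigma> 1 < 1"
      using mult_left_mono[of "phi \<alpha> \<sigma> 1" "max (phi \<alpha> \<sigma> 1) (Psi \<alpha> \<sigma> 1)" \<epsilon>]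
        mult_left_mono[of "Psi \<alpha> \<sigma> 1" "max (phi \<alpha> \<sigma> 1) (Psi \<alpha> \<sigma> 1)" \<epsilon>] \<epsilon>(1)
      by linarith+
    then have "\<epsilon> < inverse (phi \<alpha> \<sigma> 1)" "\<epsilon> < inverse (Psi \<alpha> \<sigma> 1)"
      using phi1_pos Psi1_pos by (simp_all add: inverse_eq_divide pos_less_divide_eq)
    then have n\<epsilon>: "\<epsilon> * phi \<alpha> \<sigma> (real (\<nu> \<epsilon>)) \<le> 1" "\<epsilon> * Psi \<alpha> \<sigma> (real (\<eta> \<epsilon>)) \<le> 1"
      using hyps(11,12) \<epsilon>(1) by blast+
    have n: "1 \<le> \<nu> \<epsilon>" "1 \<le> \<eta> \<epsilon>"
      using hyps(10) \<epsilon>(1) by blast+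
    note D = D_ball_bounds[OF hyps(2,3) assms(1) hyps(4) pos hyps(7,8) lam_pos dom n(1) \<epsilon>(1) n\<epsilon>(1)]
    note S = S_ball_bounds[OF hyps(2,3) assms(1) hyps(4) pos hyps(7,8) lam_pos dom n(2) \<epsilon>(1) n\<epsilon>(2)]
    show ?thesis
    proof (intro conjI impI)
      show "measure \<mu> (D_ball \<epsilon>) \<le> c1 * exp (- H \<alpha> \<sigma> (real (\<nu> \<epsilon>)) - ln \<epsilon>)"
        by (rule le_mult_exp, rule D(1)) (use ln1 c1 in auto)
      show "measure \<mu> (S_ball \<epsilon>) \<le> exp 2 * c2 * exp (- K \<alpha> \<sigma> (real (\<eta> \<epsilon>)) - ln \<epsilon>)"
        by (rule le_mult_exp, rule S(1)) (use ln1 c2 ln_c2 in auto)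
      assume conv: "convex_on {1..} (\<lambda>x. ln (\<sigma> x))"
      show "measure \<mu> (D_ball \<epsilon>) \<le> c1 * exp (- H \<alpha> \<sigma> (real (\<nu> \<epsilon>)) - 1 / 2 * ln \<epsilon>)"
        by (rule le_mult_exp, rule D(2)) (use conv ln2 c1 in auto)
      show "measure \<mu> (S_ball \<epsilon>)
          \<le> exp 2 * c2 * exp (- K \<alpha> \<sigma> (real (\<eta> \<epsilon>)) - 1 / 4 * ln (\<epsilon>\<^sup>2 * real (\<eta> \<epsilon>)))"
        by (rule le_mult_exp, rule S(2)) (use conv ln2 c2 ln_c2 in auto)
    qed
  qed
  have const_pos: "0 < c1" "0 < exp 2 * c2"
    using c1 c2 by simp_all
  show ?thesis
    unfolding stable_char_def[symmetric]
    by (rule exI[of _ c1], rule conjI[OF const_pos(1)],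
        rule exI[of _ "exp 2 * c2"], rule conjI[OF const_pos(2)],
        rule exI[of _ c1], rule conjI[OF const_pos(1)],
        rule exI[of _ "exp 2 * c2"], rule conjI[OF const_pos(2)],
        intro allI impI, elim conjE, rule bounds) assumption+
qed

end
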